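(* For every $\epsilon>0$ and every $d<\omega$ there exists a positive integer $m$ such that the following holds. Let $\mathcal{H}\subseteq\mathcal{C}$ be families of subsets of $\mathbb{R}^2$, all of whose elements are Borel measurable, such that (a) $\mathcal{H}$ is a hypothesis class with slicewise $\mathrm{VC}$-dimension at most $d$, and (b) $\mathcal{C}$ is $\mathcal{H}$-definably realizable on grids, witnessed by a family of $\mathcal{L}$-formulas $\{\varphi_k(x,y;\overline{z}_k,\overline{w}_k):k<\omega\}$. Then for all Borel probability measures $\mu_0,\mu_1$ on $\mathbb{R}$: (1) for every $C\in\mathcal{C}$ there exist parameters $\overline{c}\in\mathbb{R}^{2m+m^2}$ such that $(\mu_0\otimes\mu_1)\bigl(\varphi_m(\mathbb{R}^2;\overline{c})\,\triangle\, C\bigr)\le \epsilon/2$; (2) there exist $\overline{a},\overline{b}\in\mathbb{R}^m$ such that for every $C\in\mathcal{C}$ there exists $\overline{\ell}\in\{0,1\}^{m^2}$ with $(\mu_0\otimes\mu_1)\bigl(\varphi_m(\mathbb{R}^2;\overline{a}^\frown\overline{b},\overline{\ell})\,\triangle\, C\bigr)\le\epsilon$; (3) if $\overline{\mathbf a}=(\mathbf a_0,\dots,\mathbf a_{m-1})$ is sampled i.i.d. from $\mu_0$ and $\overline{\mathbf b}=(\mathbf b_0,\dots,\mathbf b_{m-1})$ is sampled i.i.d. from $\mu_1$, independently, then with probability at least $1/2$ the pair $(\overline{\mathbf a},\overline{\mathbf b})$ satisfies the property of item (2).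
   Context: $\mathcal{L}=\{+,\times,-,0,1,<\}$ is the language of ordered rings, interpreted in the real field $(\mathbb{R};+,\times,-,0,1,<)$; for a formula $\varphi(x,y;\overline{p})$ and parameters $\overline{c}$, $\varphi(\mathbb{R}^2;\overline{c})=\{(x,y)\in\mathbb{R}^2:\mathbb{R}\models\varphi(x,y;\overline{c})\}$. $A\triangle B$ denotes symmetric difference and $\mu_0\otimes\mu_1$ the product measure. A family $\mathcal{H}\subseteq\mathcal{P}(\mathbb{R}^2)$ is a hypothesis class if it is equipped with a $\sigma$-algebra such that: (i) the evaluation map $\mathrm{ev}:\mathcal{H}\times\mathbb{R}^2\to\{0,1\}$, $\mathrm{ev}(H,\overline{x})=1$ iff $\overline{x}\in H$, is measurable for the product of the $\sigma$-algebra on $\mathcal{H}$ and the Borel $\sigma$-algebra of $\mathbb{R}^2$; (ii) every singleton $\{H\}$, $H\in\mathcal{H}$, is measurable; (iii) for every standard Borel space $\Upsilon$ and every measurable $Y\subseteq\mathcal{H}\times\Upsilon$, the projection $\{\upsilon\in\Upsilon:\exists H\in\mathcal{H},(H,\upsilon)\in Y\}$ is universally measurable (measurable in every completion of a Borel probability measure on $\Upsilon$). $\mathcal{H}$ has slicewise $\mathrm{VC}$-dimension at most $d$ if for every $w,z_0,\dots,z_d\in\mathbb{R}$ there exist $A,B\subseteq\{0,\dots,d\}$ such that for every $H\in\mathcal{H}$, $\{i\le d:(w,z_i)\in H\}\ne A$ and $\{i\le d:(z_i,w)\in H\}\ne B$. Given $\overline{a}=(a_0,\dots,a_{m-1}),\overline{b}=(b_0,\dots,b_{m-1})\in\mathbb{R}^m$,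 the grid is $\Gamma(\overline{a},\overline{b})=\{(a_i,b_j):i,j<m\}$; the labeling induced by a set $C$ is $\overline{\ell}\in\{0,1\}^{m^2}$ with $\ell_{ij}=1$ iff $(a_i,b_j)\in C$. $\mathcal{C}$ is $\mathcal{H}$-definably realizable on grids, witnessed by $\{\varphi_k:k<\omega\}$, if each $\varphi_k(x,y;\overline{z}_k,\overline{w}_k)$ is an $\mathcal{L}$-formula (without other parameters) with $|\overline{z}_k|=2k$, $|\overline{w}_k|=k^2$, and for every $k$, every $\overline{a},\overline{b}\in\mathbb{R}^k$ and every $C\in\mathcal{C}$, letting $\overline{\ell}$ be the labeling of $\Gamma(\overline{a},\overline{b})$ induced by $C$: the set $\varphi_k(\mathbb{R}^2;\overline{a}^\frown\overline{b},\overline{\ell})$ belongs to $\mathcal{H}$, and it contains exactly the same points of $\Gamma(\overline{a},\overline{b})$ as $C$. *)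

theory Defs
  imports "HOL-Probability.Probability"
begin

section \<open>First-order formulas in the language of ordered rings\<close>

text \<open>Variables are natural numbers, bound variables are named, and equality is a logical symbol.\<close>

datatype oring_term =
    Var nat
  | Zero
  | One
  | Add oring_term oring_term
  | Mul oring_term oring_term
  | Neg oring_term

datatype oring_formula =
    Eq oring_term oring_term
  | Less oring_term oring_term
  | Not oring_formula
  | And oring_formula oring_formula
  | Or oring_formula oring_formula
  | Exists nat oring_formula
  | Forall nat oring_formula

primrec term_vars :: "oring_term \<Rightarrow> nat set" where
  "term_vars (Var n) = {n}"
| "term_vars Zero = {}"
| "term_vars One = {}"
| "term_vars (Add s t) = term_vars s \<union> term_vars t"
| "term_vars (Mul s t) = term_vars s \<union> term_vars t"
| "term_vars (Neg t) = term_vars t"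

primrec free_vars :: "oring_formula \<Rightarrow> nat set" where
  "free_vars (Eq s t) = term_vars s \<union> term_vars t"
| "free_vars (Less s t) = term_vars s \<union> term_vars t"
| "free_vars (Not \<phi>) = free_vars \<phi>"
| "free_vars (And \<phi> \<psi>) = free_vars \<phi> \<union> free_vars \<psi>"
| "free_vars (Or \<phi> \<psi>) = free_vars \<phi> \<union> free_vars \<psi>"
| "free_vars (Exists n \<phi>) = free_vars \<phi> - {n}"
| "free_vars (Forall n \<phi>) = free_vars \<phi> - {n}"

primrec term_val :: "(nat \<Rightarrow> real) \<Rightarrow> oring_term \<Rightarrow> real" where
  "term_val e (Var n) = e n"
| "term_val e Zero = 0"
| "term_val e One = 1"
| "term_val e (Add s t) = term_val e s + term_val e t"
| "term_val e (Mul s t) = term_val e s * term_val e t"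
| "term_val e (Neg t) = - term_val e t"

primrec sat :: "(nat \<Rightarrow> real) \<Rightarrow> oring_formula \<Rightarrow> bool" where
  "sat e (Eq s t) \<longleftrightarrow> term_val e s = term_val e t"
| "sat e (Less s t) \<longleftrightarrow> term_val e s < term_val e t"
| "sat e (Not \<phi>) \<longleftrightarrow> \<not> sat e \<phi>"
| "sat e (And \<phi> \<psi>) \<longleftrightarrow> sat e \<phi> \<and> sat e \<psi>"
| "sat e (Or \<phi> \<psi>) \<longleftrightarrow> sat e \<phi> \<or> sat e \<psi>"
| "sat e (Exists n \<phi>) \<longleftrightarrow> (\<exists>r. sat (e(n := r)) \<phi>)"
| "sat e (Forall n \<phi>) \<longleftrightarrow> (\<forall>r. sat (e(n := r)) \<phi>)"

text \<open>
  Tuples in \<open>\<real>\<^sup>n\<close> are extensional functions on \<open>{..<n}\<close>; this is also the carrier of the product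
  measures \<open>PiM {..<n}\<close> below.
\<close>

abbreviation tuples :: "nat \<Rightarrow> (nat \<Rightarrow> real) set" where
  "tuples n \<equiv> {..<n} \<rightarrow>\<^sub>E UNIV"

text \<open>
  \<open>\<phi>(\<real>\<^sup>2; c)\<close>: variable 0 is \<open>x\<close>, variable 1 is \<open>y\<close>, and variable \<open>i + 2\<close> is the parameter slot for \<open>c i\<close>.
\<close>

definition definable_set :: "oring_formula \<Rightarrow> (nat \<Rightarrow> real) \<Rightarrow> (real \<times> real) set" where
  "definable_set \<phi> c = {(x, y). sat (case_nat x (case_nat y c)) \<phi>}"

section \<open>Hypothesis classes\<close>

definition standard_borel :: "'a measure \<Rightarrow> bool" where
  "standard_borel \<Upsilon> \<longleftrightarrow>
     (\<exists>T. completely_metrizable_space T \<and> second_countable T \<and> topspace T = space \<Upsilon> \<and>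
          sets \<Upsilon> = sigma_sets (topspace T) {U. openin T U})"

definition universally_measurable :: "'a measure \<Rightarrow> 'a set \<Rightarrow> bool" where
  "universally_measurable \<Upsilon> A \<longleftrightarrow>
     (\<forall>\<nu>. prob_space \<nu> \<and> sets \<nu> = sets \<Upsilon> \<longrightarrow> A \<in> sets (completion \<nu>))"

text \<open>
  Only the \<open>\<sigma>\<close>-algebra of the measures \<open>M\<close> and \<open>\<Upsilon>\<close> matters.  A standard Borel space has at most
  continuum many points, so each one has an isomorphic copy whose points are of type
  \<^typ>\<open>nat \<Rightarrow> real\<close>; hence \<open>\<Upsilon>\<close> ranges over all standard Borel spaces up to isomorphism.
\<close>

definition hypothesis_class :: "(real \<times> real) set set \<Rightarrow> bool" where
  "hypothesis_class \<H> \<longleftrightarrow>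
     (\<exists>M :: (real \<times> real) set measure.
        space M = \<H> \<and>
        (\<lambda>(H, p). p \<in> H) \<in> measurable (M \<Otimes>\<^sub>M borel) (count_space (UNIV :: bool set)) \<and>
        (\<forall>H\<in>\<H>. {H} \<in> sets M) \<and>
        (\<forall>\<Upsilon> :: (nat \<Rightarrow> real) measure. standard_borel \<Upsilon> \<longrightarrow>
           (\<forall>Y \<in> sets (M \<Otimes>\<^sub>M \<Upsilon>).
              universally_measurable \<Upsilon> {\<upsilon> \<in> space \<Upsilon>. \<exists>H\<in>\<H>. (H, \<upsilon>) \<in> Y})))"

definition slicewise_VC_dim_le :: "(real \<times> real) set set \<Rightarrow> nat \<Rightarrow> bool" where
  "slicewise_VC_dim_le \<H> d \<longleftrightarrow>
     (\<forall>(w :: real) (z :: nat \<Rightarrow> real). \<exists>A B. A \<subseteq> {0..d} \<and> B \<subseteq> {0..d} \<and>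
        (\<forall>H\<in>\<H>. {i \<in> {0..d}. (w, z i) \<in> H} \<noteq> A \<and> {i \<in> {0..d}. (z i, w) \<in> H} \<noteq> B))"

section \<open>Grids and definable realizability\<close>

definition grid :: "nat \<Rightarrow> (nat \<Rightarrow> real) \<Rightarrow> (nat \<Rightarrow> real) \<Rightarrow> (real \<times> real) set" where
  "grid k a b = {(a i, b j) | i j. i < k \<and> j < k}"

abbreviation labelings :: "nat \<Rightarrow> (nat \<times> nat \<Rightarrow> real) set" where
  "labelings k \<equiv> ({..<k} \<times> {..<k}) \<rightarrow>\<^sub>E {0, 1}"

definition induced_labeling ::
  "nat \<Rightarrow> (nat \<Rightarrow> real) \<Rightarrow> (nat \<Rightarrow> real) \<Rightarrow> (real \<times> real) set \<Rightarrow> nat \<times> nat \<Rightarrow> real" where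
  "induced_labeling k a b C =
     (\<lambda>(i, j) \<in> {..<k} \<times> {..<k}. if (a i, b j) \<in> C then 1 else 0)"

text \<open>The tuple \<open>a\<frown>b, l\<close> in \<open>\<real>\<^bsup>2k+k\<^sup>2\<^esup>\<close>, with the labels listed row by row.\<close>

definition grid_params ::
  "nat \<Rightarrow> (nat \<Rightarrow> real) \<Rightarrow> (nat \<Rightarrow> real) \<Rightarrow> (nat \<times> nat \<Rightarrow> real) \<Rightarrow> nat \<Rightarrow> real" where
  "grid_params k a b l =
     (\<lambda>n \<in> {..<2 * k + k\<^sup>2}.
        if n < k then a n
        else if n < 2 * k then b (n - k)
        else l ((n - 2 * k) div k, (n - 2 * k) mod k))"

definition definably_realizable_on_grids ::
  "(real \<times> real) set set \<Rightarrow> (real \<times> real) set set \<Rightarrow> (nat \<Rightarrow> oring_formula) \<Rightarrow> bool" where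
  "definably_realizable_on_grids \<H> \<C> \<phi> \<longleftrightarrow>
     (\<forall>k. free_vars (\<phi> k) \<subseteq> {..<2 + (2 * k + k\<^sup>2)} \<and>
        (\<forall>a \<in> tuples k. \<forall>b \<in> tuples k. \<forall>C \<in> \<C>.
           let D = definable_set (\<phi> k) (grid_params k a b (induced_labeling k a b C))
           in D \<in> \<H> \<and> D \<inter> grid k a b = C \<inter> grid k a b))"

section \<open>Approximation\<close>

text \<open>
  The Borel conjunct makes the measure of the symmetric difference meaningful: \<^const>\<open>measure\<close>
  is 0 on non-measurable sets.  For Borel \<open>C\<close> and \<open>D\<close> of the form \<^term>\<open>definable_set \<phi> c\<close> it
  always holds, as \<open>D\<close> is semialgebraic by Tarski-Seidenberg.
\<close>

definition close_to ::
  "real measure \<Rightarrow> real measure \<Rightarrow> real \<Rightarrow> (real \<times> real) set \<Rightarrow> (real \<times> real) set \<Rightarrow> bool" where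
  "close_to \<mu>\<^sub>0 \<mu>\<^sub>1 \<delta> D C \<longleftrightarrow>
     D \<in> sets borel \<and> measure (\<mu>\<^sub>0 \<Otimes>\<^sub>M \<mu>\<^sub>1) (sym_diff D C) \<le> \<delta>"

definition grid_approximates ::
  "real measure \<Rightarrow> real measure \<Rightarrow> real \<Rightarrow> (real \<times> real) set set \<Rightarrow> nat \<Rightarrow> oring_formula \<Rightarrow>
   (nat \<Rightarrow> real) \<Rightarrow> (nat \<Rightarrow> real) \<Rightarrow> bool" where
  "grid_approximates \<mu>\<^sub>0 \<mu>\<^sub>1 \<epsilon> \<C> m \<phi> a b \<longleftrightarrow>
     (\<forall>C\<in>\<C>. \<exists>l \<in> labelings m. close_to \<mu>\<^sub>0 \<mu>\<^sub>1 \<epsilon> (definable_set \<phi> (grid_params m a b l)) C)"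

text \<open>
  ``With probability at least \<open>p\<close>'': the property holds throughout some event of probability at
  least \<open>p\<close>.  For a measurable property this is the usual meaning.
\<close>

definition with_prob_at_least :: "'a measure \<Rightarrow> real \<Rightarrow> ('a \<Rightarrow> bool) \<Rightarrow> bool" where
  "with_prob_at_least P p Q \<longleftrightarrow> (\<exists>E \<in> sets P. measure P E \<ge> p \<and> (\<forall>\<omega>\<in>E. Q \<omega>))"

end

theory Submission
  imports Defs "HOL-Real_Asymp.Real_Asymp"
begin

text \<open>
  Let two members \<open>G\<close>, \<open>H\<close> of a slicewise VC class agree on a random grid.  First sample \<open>r\<close> points
  \<open>b\<^sub>j\<close> from \<open>\<mu>\<^sub>1\<close>: by the classical \<open>\<epsilon>\<close>-net argument applied to the slices at a fixed \<open>x\<close> and by Fubini,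
  for all but few \<open>x\<close>, uniformly in \<open>G\<close> and \<open>H\<close>, a large slice of \<open>G \<triangle> H\<close> at \<open>x\<close> contains some \<open>b\<^sub>j\<close>.
  So if \<open>G \<triangle> H\<close> is large, the set of those \<open>x\<close> with \<open>(x, b\<^sub>j) \<in> G \<triangle> H\<close> for some \<open>j < r\<close> is large.
  For fixed \<open>b\<close> such sets have only polynomially many traces on finite sets, as each is a union of
  \<open>r\<close> differences of horizontal slices; hence far more than \<open>r\<close> points \<open>a\<^sub>i\<close> from \<open>\<mu>\<^sub>0\<close> hit all of them.

  A set \<open>C \<in> \<C>\<close> shows on finite grids only patterns of members of \<open>\<H>\<close>, so \<open>\<H> \<union> {C}\<close> is again slicewise
  VC, and the definable member of \<open>\<H>\<close> agreeing with \<open>C\<close> on a good grid is close to \<open>C\<close>.  A grid that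
  is good for \<open>\<H>\<close> then serves all \<open>C\<close> at once: label it by a member of \<open>\<H>\<close> close to \<open>C\<close>.
\<close>

section \<open>Finite combinatorics: Sauer-Shelah and counting swaps\<close>

definition shattered :: "'a set set \<Rightarrow> 'a set \<Rightarrow> bool" where
  "shattered F K \<longleftrightarrow> (\<forall>A\<subseteq>K. \<exists>B\<in>F. B \<inter> K = A)"

text \<open>Pajor's form of the Sauer-Shelah lemma, by induction on X. The family is split at a
  point x into the members avoiding x and the members containing x, the latter with x deleted.
  Whatever one half shatters, the whole family shatters; whatever both halves shatter remains
  shattered after x is added.\<close>

lemma card_le_card_shattered:
  assumes "finite X" "F \<subseteq> Pow X"
  shows "card F \<le> card {K. K \<subseteq> X \<and> shattered F K}"
  using assms
proof (induction X arbitrary: F rule: finite_induct)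
  case empty
  then have "F = {} \<or> F = {{}}" by auto
  then show ?case
  proof
    have eq: "{K. K \<subseteq> {} \<and> shattered {{}} K} = {{}}"
      by (auto simp: shattered_def)
    show ?case if "F = {{}}" unfolding that eq by simp
  qed simp
next
  case (insert x X)
  define F0 where "F0 = {B\<in>F. x \<notin> B}"
  define F1 where "F1 = (\<lambda>B. B - {x}) ` {B\<in>F. x \<in> B}"
  define S where "S F = {K. K \<subseteq> X \<and> shattered F K}" for F
  have fin: "finite F" using insert by (meson finite_Pow_iff finite_insert finite_subset)
  have "card F = card F0 + card {B\<in>F. x \<in> B}"
    unfolding F0_def using fin by (subst card_Un_disjoint[symmetric]) (auto intro!: arg_cong[of _ _ card])
  also have "card {B\<in>F. x \<in> B} = card F1"
    unfolding F1_def by (rule card_image[symmetric]) (auto simp: inj_on_def)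
  also have "card F0 + card F1 \<le> card (S F0) + card (S F1)"
    unfolding S_def using insert.prems insert.hyps
    by (intro add_mono insert.IH) (auto simp: F0_def F1_def)
  also have "\<dots> = card (S F0 \<union> S F1) + card (S F0 \<inter> S F1)"
    using insert.hyps by (intro card_Un_Int) (auto simp: S_def)
  \<comment> \<open>Sets shattered by both halves are counted twice. The second count is charged to
    the same set with x added, which is not a subset of X.\<close>
  also have "card (S F0 \<inter> S F1) = card (Set.insert x ` (S F0 \<inter> S F1))"
    using insert.hyps by (intro card_image[symmetric]) (auto simp: inj_on_def S_def)
  also have "card (S F0 \<union> S F1) + \<dots> = card ((S F0 \<union> S F1) \<union> Set.insert x ` (S F0 \<inter> S F1))"
    using insert.hyps by (intro card_Un_disjoint[symmetric]) (auto simp: S_def)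
  also have "\<dots> \<le> card {K. K \<subseteq> Set.insert x X \<and> shattered F K}"
  proof (rule card_mono)
    show "finite {K. K \<subseteq> Set.insert x X \<and> shattered F K}" using insert.hyps by auto
    have "shattered F K" if "K \<in> S F0" for K
      unfolding shattered_def
    proof (intro allI impI)
      fix A assume "A \<subseteq> K"
      with that obtain B where "B \<in> F0" "B \<inter> K = A"
        unfolding S_def shattered_def by blast
      then show "\<exists>B\<in>F. B \<inter> K = A" by (auto simp: F0_def)
    qed
    moreover have "shattered F K" if "K \<in> S F1" for K
      unfolding shattered_def
    proof (intro allI impI)
      fix A assume "A \<subseteq> K"
      with that obtain B' where "B' \<in> F1" "B' \<inter> K = A" and "K \<subseteq> X"
        unfolding S_def shattered_def by blast
      then obtain B where "B \<in> F" "x \<in> B" "(B - {x}) \<inter> K = A"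
        unfolding F1_def by blast
      then show "\<exists>B\<in>F. B \<inter> K = A" using insert.hyps \<open>K \<subseteq> X\<close> by (intro bexI[of _ B]) auto
    qed
    moreover have "shattered F (Set.insert x K)" if K: "K \<in> S F0" "K \<in> S F1" for K
      unfolding shattered_def
    proof (intro allI impI)
      fix A assume A: "A \<subseteq> Set.insert x K"
      have xK: "x \<notin> K" using K insert.hyps by (auto simp: S_def)
      show "\<exists>B\<in>F. B \<inter> Set.insert x K = A"
      proof (cases "x \<in> A")
        case True
        have "A - {x} \<subseteq> K" using A by auto
        moreover have "shattered F1 K" using K(2) by (simp add: S_def)
        ultimately obtain B' where "B' \<in> F1" "B' \<inter> K = A - {x}"
          unfolding shattered_def by meson
        then obtain B where "B \<in> F" "x \<in> B" "(B - {x}) \<inter> K = A - {x}"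
          unfolding F1_def by blast
        then show ?thesis using True xK by (intro bexI[of _ B]) auto
      next
        case False
        then have "A \<subseteq> K" using A by auto
        moreover have "shattered F0 K" using K(1) by (simp add: S_def)
        ultimately obtain B where "B \<in> F0" "B \<inter> K = A"
          unfolding shattered_def by meson
        then have "B \<in> F" "x \<notin> B" "B \<inter> K = A"
          unfolding F0_def by auto
        then show ?thesis using False xK by (intro bexI[of _ B]) auto
      qed
    qed
    ultimately show "S F0 \<union> S F1 \<union> Set.insert x ` (S F0 \<inter> S F1)
        \<subseteq> {K. K \<subseteq> Set.insert x X \<and> shattered F K}"
      by (auto simp: S_def)
  qed
  finally show ?case .
qed

text \<open>A set of at most d + 1 elements is one of at most d elements with at most one point
  added; \<open>None\<close> stands for adding nothing. The bound is crude, but only polynomial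
  growth matters later.\<close>

lemma card_subsets_card_le:
  assumes "finite X"
  shows "card {K. K \<subseteq> X \<and> card K \<le> d} \<le> (card X + 1) ^ d"
proof (induction d)
  case 0
  have "{K. K \<subseteq> X \<and> card K \<le> 0} = {{}}" using assms by (auto dest: finite_subset)
  then show ?case by simp
next
  case (Suc d)
  let ?f = "\<lambda>(z, K). case z of None \<Rightarrow> K | Some x \<Rightarrow> Set.insert x K"
  let ?D = "Set.insert None (Some ` X) \<times> {K. K \<subseteq> X \<and> card K \<le> d}"
  have "K \<in> ?f ` ?D" if "K \<subseteq> X" "card K \<le> Suc d" for K
  proof (cases "K = {}")
    case True
    then show ?thesis by (intro image_eqI[of _ _ "(None, {})"]) auto
  next
    case False
    then obtain x where "x \<in> K" by auto
    then have "K = ?f (Some x, K - {x})" by auto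
    moreover have "card (K - {x}) \<le> d"
      using that \<open>x \<in> K\<close> by simp
    ultimately show ?thesis
      using that \<open>x \<in> K\<close> by (intro image_eqI[of _ _ "(Some x, K - {x})"]) auto
  qed
  then have "card {K. K \<subseteq> X \<and> card K \<le> Suc d} \<le> card (?f ` ?D)"
    using assms by (intro card_mono) auto
  also have "\<dots> \<le> card ?D" using assms by (intro card_image_le) auto
  also have "\<dots> = (card X + 1) * card {K. K \<subseteq> X \<and> card K \<le> d}"
    using assms by (simp add: card_cartesian_product card_image)
  also have "\<dots> \<le> (card X + 1) ^ Suc d"
    using mult_le_mono2[OF Suc, of "card X + 1"] by simp
  finally show ?case .
qed

text \<open>Shattering passes to subsets, so excluding size d + 1 excludes every larger size, and
  only sets of size at most d remain to be counted.\<close>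

lemma sauer_shelah:
  assumes "finite X" "F \<subseteq> Pow X" "\<And>K. K \<subseteq> X \<Longrightarrow> card K = Suc d \<Longrightarrow> \<not> shattered F K"
  shows "card F \<le> (card X + 1) ^ d"
proof -
  have "card K \<le> d" if "K \<subseteq> X" "shattered F K" for K
  proof (rule ccontr)
    assume "\<not> card K \<le> d"
    then obtain L where L: "L \<subseteq> K" "card L = Suc d"
      by (meson not_less_eq_eq obtain_subset_with_card_n)
    have "shattered F L"
      unfolding shattered_def
    proof (intro allI impI)
      fix A assume "A \<subseteq> L"
      with that L obtain B where "B \<in> F" "B \<inter> K = A" unfolding shattered_def by blast
      then show "\<exists>B\<in>F. B \<inter> L = A" using L \<open>A \<subseteq> L\<close> by (intro bexI[of _ B]) auto
    qed
    with L that assms(3) show False by auto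
  qed
  then have "card {K. K \<subseteq> X \<and> shattered F K} \<le> card {K. K \<subseteq> X \<and> card K \<le> d}"
    using assms(1) by (intro card_mono) auto
  with card_le_card_shattered[OF assms(1,2)] card_subsets_card_le[OF assms(1), of d]
  show ?thesis by linarith
qed

text \<open>Membership of i in \<sigma> is forced wherever \<open>P i\<close> or \<open>Q i\<close>
  holds, so \<sigma> is determined by its part outside \<open>K\<close>.\<close>

lemma card_swaps_le:
  assumes "finite I" and k: "k \<le> card {i\<in>I. P i \<or> Q i}"
  shows "card {\<sigma>. \<sigma> \<subseteq> I \<and> (\<forall>i\<in>I. if i \<in> \<sigma> then \<not> Q i else \<not> P i) } * 2 ^ k \<le> 2 ^ card I"
proof -
  define K where "K = {i\<in>I. P i \<or> Q i}"
  let ?S = "{\<sigma>. \<sigma> \<subseteq> I \<and> (\<forall>i\<in>I. if i \<in> \<sigma> then \<not> Q i else \<not> P i) }"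
  have "inj_on (\<lambda>\<sigma>. \<sigma> - K) ?S"
  proof (rule inj_onI)
    fix \<sigma> \<tau> assume s: "\<sigma> \<in> ?S" "\<tau> \<in> ?S" "\<sigma> - K = \<tau> - K"
    have "i \<in> \<sigma> \<longleftrightarrow> i \<in> \<tau>" for i
    proof (cases "i \<in> K")
      case True
      then have "i \<in> I" "P i \<or> Q i" by (auto simp: K_def)
      with s(1,2) show ?thesis by (auto split: if_splits)
    qed (use s(3) in auto)
    then show "\<sigma> = \<tau>" by auto
  qed
  then have "card ?S \<le> card (Pow (I - K))"
    by (rule card_inj_on_le) (use assms in auto)
  also have "\<dots> = 2 ^ (card I - card K)"
    using assms by (simp add: card_Pow card_Diff_subset K_def)
  finally have "card ?S * 2 ^ k \<le> 2 ^ (card I - card K) * 2 ^ card K"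
    using k by (intro mult_mono) (auto simp: K_def)
  also have "\<dots> = 2 ^ card I"
    using assms by (simp add: power_add[symmetric] K_def card_mono)
  finally show ?thesis .
qed

section \<open>Universal measurability and grid patterns\<close>

text \<open>A set of the completion is a measurable set plus part of a null set. Both approximations
  serve later: the probability bound is proved for S, while the covering argument needs the hull
  W.\<close>

lemma universally_measurableD:
  assumes "universally_measurable Y Z" "prob_space \<nu>" "sets \<nu> = sets Y"
  obtains S W where "S \<in> sets \<nu>" "W \<in> sets \<nu>" "S \<subseteq> Z" "Z \<subseteq> W" "measure \<nu> W = measure \<nu> S"
proof -
  interpret prob_space \<nu> by fact
  have "Z \<in> sets (completion \<nu>)" using assms by (auto simp: universally_measurable_def)
  then obtain S N N' where *: "Z = S \<union> N" "N \<subseteq> N'" "N' \<in> null_sets \<nu>" "S \<in> sets \<nu>"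
    by (rule sets_completionE)
  then have "measure \<nu> (S \<union> N') = measure \<nu> S"
    by (intro measure_Un_null_set) auto
  with * show thesis by (intro that[of S "S \<union> N'"]) auto
qed

lemma universally_measurable_sets: "Z \<in> sets Y \<Longrightarrow> universally_measurable Y Z"
  by (auto simp: universally_measurable_def)

lemma universally_measurable_UN:
  assumes "countable I" "\<And>i. i \<in> I \<Longrightarrow> universally_measurable Y (Z i)"
  shows "universally_measurable Y (\<Union>i\<in>I. Z i)"
  using assms by (auto simp: universally_measurable_def intro!: sets.countable_UN')

lemma universally_measurable_Int:
  assumes "universally_measurable Y A" "universally_measurable Y B"
  shows "universally_measurable Y (A \<inter> B)"
  using assms by (auto simp: universally_measurable_def)

lemma universally_measurable_Un:
  assumes "universally_measurable Y A" "universally_measurable Y B"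
  shows "universally_measurable Y (A \<union> B)"
  using assms by (auto simp: universally_measurable_def)

lemma standard_borel_borel: "standard_borel (borel :: 'a :: polish_space measure)"
  unfolding standard_borel_def
proof (intro exI[of _ euclidean] conjI)
  show "second_countable (euclidean :: 'a topology)"
  proof -
    obtain B :: "'a set set" where B: "countable B" "topological_basis B"
      using ex_countable_basis by auto
    then show ?thesis
      unfolding second_countable_def
      by (intro exI[of _ B] conjI allI impI ballI)
         (assumption, metis open_openin topological_basis_open, metis open_openin topological_basisE)
  qed
  show "sets (borel :: 'a measure) = sigma_sets (topspace euclidean) {U. openin euclidean U}"
    unfolding borel_def by (simp add: Collect_mono)
qed (simp_all add: completely_metrizable_space_euclidean)

text \<open>One sequence supplies both coordinates. A rectangular grid is then a block of a single
  square pattern, converses transpose patterns, and the parameter space is the one Polish space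
  \<open>nat \<Rightarrow> real\<close>.\<close>

definition grid_pattern :: "nat \<Rightarrow> (nat \<Rightarrow> real) \<Rightarrow> (real \<times> real) set \<Rightarrow> (nat \<times> nat) set" where
  "grid_pattern N v H = {(i, j). i < N \<and> j < N \<and> (v i, v j) \<in> H}"

text \<open>
  Condition (iii) only allows projecting along one copy of \<open>\<H>\<close>.  Events about pairs of hypotheses stay
  tractable because they depend only on the two patterns on finitely many points, so they are finite
  Boolean combinations of the sets below.
\<close>

definition patterns_universally_measurable :: "(real \<times> real) set set \<Rightarrow> bool" where
  "patterns_universally_measurable \<G> \<longleftrightarrow>
     (\<forall>N p. universally_measurable (borel :: (nat \<Rightarrow> real) measure)
              {v. \<exists>H\<in>\<G>. grid_pattern N v H = p})"

lemma grid_pattern_subset: "grid_pattern N v H \<in> Pow ({..<N} \<times> {..<N})"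
  by (auto simp: grid_pattern_def)

text \<open>By (i), having a given pattern is a finite Boolean combination of evaluations and so a
  measurable condition on the pair (H, v); (iii) then projects it along H.\<close>

lemma hypothesis_class_patterns:
  assumes "hypothesis_class \<H>"
  shows "patterns_universally_measurable \<H>"
  unfolding patterns_universally_measurable_def
proof (intro allI)
  fix N p
  obtain M :: "(real \<times> real) set measure" where M: "space M = \<H>"
    "(\<lambda>(H, p). p \<in> H) \<in> measurable (M \<Otimes>\<^sub>M borel) (count_space (UNIV :: bool set))"
    and proj: "\<And>Y. Y \<in> sets (M \<Otimes>\<^sub>M (borel :: (nat \<Rightarrow> real) measure)) \<Longrightarrow>
      universally_measurable borel {v \<in> space borel. \<exists>H\<in>\<H>. (H, v) \<in> Y}"
  proof -
    from assms obtain M :: "(real \<times> real) set measure" where "space M = \<H>"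
      "(\<lambda>(H, p). p \<in> H) \<in> measurable (M \<Otimes>\<^sub>M borel) (count_space (UNIV :: bool set))"
      "\<forall>\<Upsilon> :: (nat \<Rightarrow> real) measure. standard_borel \<Upsilon> \<longrightarrow> (\<forall>Y \<in> sets (M \<Otimes>\<^sub>M \<Upsilon>).
              universally_measurable \<Upsilon> {\<upsilon> \<in> space \<Upsilon>. \<exists>H\<in>\<H>. (H, \<upsilon>) \<in> Y})"
      unfolding hypothesis_class_def by auto
    with standard_borel_borel[where 'a="nat \<Rightarrow> real"] show thesis by (intro that) auto
  qed
  let ?B = "borel :: (nat \<Rightarrow> real) measure"
  have coord: "(\<lambda>v. v i) \<in> borel_measurable ?B" for i :: nat
    by (intro borel_measurable_continuous_onI continuous_on_product_coordinates)
  have [measurable]: "Measurable.pred (M \<Otimes>\<^sub>M ?B) (\<lambda>(H, v). (v i, v j) \<in> H)" for i j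
  proof -
    have "(\<lambda>(H, v). (H, (v i, v j))) \<in> measurable (M \<Otimes>\<^sub>M ?B) (M \<Otimes>\<^sub>M borel)"
      using measurable_compose[OF measurable_snd coord[of i], of M]
        measurable_compose[OF measurable_snd coord[of j], of M]
      by (simp add: borel_prod[symmetric] case_prod_beta)
    from measurable_compose[OF this M(2)] show ?thesis by (simp add: case_prod_beta)
  qed
  let ?Y = "{x \<in> space (M \<Otimes>\<^sub>M ?B). \<forall>i<N. \<forall>j<N. (case x of (H, v) \<Rightarrow> (v i, v j) \<in> H) \<longleftrightarrow> (i, j) \<in> p}"
  have "?Y \<in> sets (M \<Otimes>\<^sub>M ?B)" by measurable
  note * = proj[OF this]
  show "universally_measurable ?B {v. \<exists>H\<in>\<H>. grid_pattern N v H = p}"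
  proof (cases "p \<subseteq> {..<N} \<times> {..<N}")
    case True
    have "grid_pattern N v H = p \<longleftrightarrow> (\<forall>i<N. \<forall>j<N. (v i, v j) \<in> H \<longleftrightarrow> (i, j) \<in> p)" for v H
      using True by (auto simp: grid_pattern_def)
    then have "{v \<in> space ?B. \<exists>H\<in>\<H>. (H, v) \<in> ?Y} = {v. \<exists>H\<in>\<H>. grid_pattern N v H = p}"
      using M(1) by (auto simp: space_pair_measure)
    with * show ?thesis by simp
  next
    case False
    then have "{v. \<exists>H\<in>\<H>. grid_pattern N v H = p} = {}"
      using grid_pattern_subset by auto
    then show ?thesis by (simp add: universally_measurable_sets)
  qed
qed

text \<open>The enlarged class is not shown to be a hypothesis class. Only its pattern events
  matter, and those of a single Borel set are Borel.\<close>

lemma patterns_insert: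
  assumes "patterns_universally_measurable \<H>" and C: "C \<in> sets borel"
  shows "patterns_universally_measurable (Set.insert C \<H>)"
  unfolding patterns_universally_measurable_def
proof (intro allI)
  fix N p
  let ?B = "borel :: (nat \<Rightarrow> real) measure"
  have coord: "(\<lambda>v. v i) \<in> borel_measurable ?B" for i :: nat
    by (intro borel_measurable_continuous_onI continuous_on_product_coordinates)
  have pt: "(\<lambda>v. (v i, v j)) \<in> measurable ?B borel" for i j
    using coord by (simp add: borel_prod[symmetric])
  have [measurable]: "Measurable.pred ?B (\<lambda>v. (v i, v j) \<in> C)" for i j
    using measurable_compose[OF pt, of "\<lambda>x. x \<in> C"] C by simp
  have "{v. grid_pattern N v C = p} \<in> sets ?B"
  proof (cases "p \<subseteq> {..<N} \<times> {..<N}")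
    case True
    then have "{v. grid_pattern N v C = p} =
        {v \<in> space ?B. \<forall>i<N. \<forall>j<N. (v i, v j) \<in> C \<longleftrightarrow> (i, j) \<in> p}"
      by (auto simp: grid_pattern_def)
    also have "\<dots> \<in> sets ?B" by measurable
    finally show ?thesis .
  next
    case False
    then have "{v. grid_pattern N v C = p} = {}" using grid_pattern_subset by auto
    then show ?thesis by simp
  qed
  moreover have "{v. \<exists>H\<in>Set.insert C \<H>. grid_pattern N v H = p} =
      {v. grid_pattern N v C = p} \<union> {v. \<exists>H\<in>\<H>. grid_pattern N v H = p}" by auto
  ultimately show "universally_measurable ?B {v. \<exists>H\<in>Set.insert C \<H>. grid_pattern N v H = p}"
    using assms(1) unfolding patterns_universally_measurable_def
    by (simp add: universally_measurable_Un universally_measurable_sets)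
qed

text \<open>Running through the finitely many pairs (p, q) that satisfy Q separates the two
  quantifiers over \<G>, so that each factor projects a single hypothesis.\<close>

lemma universally_measurable_pair_pattern:
  assumes "patterns_universally_measurable \<G>"
  shows "universally_measurable borel
    {v. \<exists>G\<in>\<G>. \<exists>H\<in>\<G>. Q (grid_pattern N v G) (grid_pattern N v H)}"
proof -
  let ?P = "Pow ({..<N} \<times> {..<N})"
  let ?E = "\<lambda>p. {v. \<exists>H\<in>\<G>. grid_pattern N v H = p}"
  have "{v. \<exists>G\<in>\<G>. \<exists>H\<in>\<G>. Q (grid_pattern N v G) (grid_pattern N v H)} =
      (\<Union>(p, q)\<in>{(p, q) \<in> ?P \<times> ?P. Q p q}. ?E p \<inter> ?E q)" (is "?L = ?R")
  proof
    show "?L \<subseteq> ?R"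
    proof
      fix v assume "v \<in> ?L"
      then obtain G H where "G \<in> \<G>" "H \<in> \<G>" "Q (grid_pattern N v G) (grid_pattern N v H)" by auto
      then show "v \<in> ?R"
        using grid_pattern_subset[of N v G] grid_pattern_subset[of N v H]
        by (intro UN_I[of "(grid_pattern N v G, grid_pattern N v H)"]) auto
    qed
  qed auto
  moreover have "universally_measurable borel ?R"
    using assms unfolding patterns_universally_measurable_def
    by (intro universally_measurable_UN countable_finite) 
       (auto intro!: universally_measurable_Int intro: finite_subset[of _ "?P \<times> ?P"])
  ultimately show ?thesis by simp
qed

section \<open>Symmetrization of the double sample\<close>

text \<open>Bound f by c on the event and by t off it. As t is at most half of c e, a mean of at
  least c e leaves c e / 2 to be contributed by the event.\<close>

lemma (in prob_space) reverse_markov: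
  assumes f: "f \<in> borel_measurable M" "\<And>x. x \<in> space M \<Longrightarrow> 0 \<le> f x \<and> f x \<le> c"
    and t: "2 * t \<le> c * e" "e * c \<le> expectation f" "c > 0"
  shows "e / 2 \<le> prob {x\<in>space M. t \<le> f x}"
proof -
  let ?A = "{x\<in>space M. t \<le> f x}"
  have [measurable]: "f \<in> borel_measurable M" by fact
  have A: "?A \<in> events" by measurable
  \<comment> \<open>For negative t the event is everything, and c + t could fall below f; hence
    \<open>max 0 t\<close>.\<close>
  have "expectation f \<le> expectation (\<lambda>x. c * indicator ?A x + max 0 t)"
  proof (rule integral_mono)
    show "integrable M f" using f by (intro integrable_const_bound[of _ c]) auto
    show "integrable M (\<lambda>x. c * indicator ?A x + max 0 t)" by (intro Bochner_Integration.integrable_add integrable_mult_right integrable_const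
          integrable_real_indicator) (auto simp: A emeasure_eq_measure)
    show "f x \<le> c * indicator ?A x + max 0 t" if "x \<in> space M" for x
      using f(2)[OF that] that by (auto simp: indicator_def)
  qed
  also have "\<dots> = c * prob ?A + max 0 t"
    using A by (subst Bochner_Integration.integral_add) (simp_all add: prob_space emeasure_eq_measure)
  finally have "e * c \<le> c * prob ?A + max 0 t" using t by simp
  show ?thesis
  proof (cases "e \<le> 0")
    case True
    then show ?thesis by (smt (verit) divide_nonpos_pos measure_nonneg)
  next
    case False
    then have "max 0 t \<le> c * e / 2" using t mult_pos_pos[of c e] by (simp add: max_def)
    then have "c * (e / 2) \<le> c * prob ?A" using \<open>e * c \<le> c * prob ?A + max 0 t\<close> by (simp add: algebra_simps)
    then show ?thesis using t(3) by simp
  qed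
qed

text \<open>For \<sigma> inside {..<n} every index from 2n on is fixed, so this is an involution of
  all naturals and not only of the double sample.\<close>

definition swap_blocks :: "nat \<Rightarrow> nat set \<Rightarrow> nat \<Rightarrow> nat" where
  "swap_blocks n \<sigma> i =
     (if i < n then (if i \<in> \<sigma> then i + n else i) else (if i - n \<in> \<sigma> then i - n else i))"

lemma swap_blocks_involution:
  assumes "\<sigma> \<subseteq> {..<n}"
  shows "swap_blocks n \<sigma> (swap_blocks n \<sigma> i) = i"
  using assms by (auto simp: swap_blocks_def)

lemma swap_blocks_less: "\<sigma> \<subseteq> {..<n} \<Longrightarrow> i < 2 * n \<Longrightarrow> swap_blocks n \<sigma> i < 2 * n"
  by (auto simp: swap_blocks_def)

text \<open>Here \<tau> is the set of indices whose sample point is hit. At least k of the pairs {i,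
  i + n} meet \<tau>, and on each of these the demand for an empty first half dictates whether to
  swap.\<close>

lemma card_swap_blocks_le:
  "card {\<sigma>. \<sigma> \<subseteq> {..<n} \<and> (\<forall>i<n. swap_blocks n \<sigma> i \<notin> \<tau>) \<and>
      k \<le> card {i \<in> {n..<2*n}. swap_blocks n \<sigma> i \<in> \<tau>}} * 2 ^ k \<le> 2 ^ n"
  (is "card ?A * _ \<le> _")
\<comment> \<open>That k pairs meet \<tau> is read off from any member of \<open>?A\<close>; without
  a member the bound is trivial.\<close>
proof (cases "?A = {}")
  case False
  then obtain \<sigma> where "k \<le> card {i \<in> {n..<2*n}. swap_blocks n \<sigma> i \<in> \<tau>}" by blast
  also have "\<dots> \<le> card {i \<in> {..<n}. i \<in> \<tau> \<or> i + n \<in> \<tau>}"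
    by (rule card_inj_on_le[of "\<lambda>i. i - n"])
       (auto simp: inj_on_def swap_blocks_def split: if_splits)
  finally have k: "k \<le> card {i \<in> {..<n}. i \<in> \<tau> \<or> i + n \<in> \<tau>}" .
  have "card ?A \<le> card {\<sigma>. \<sigma> \<subseteq> {..<n} \<and> (\<forall>i\<in>{..<n}. if i \<in> \<sigma> then i + n \<notin> \<tau> else i \<notin> \<tau>)}"
    by (intro card_mono) (auto simp: swap_blocks_def)
  then have "card ?A * 2 ^ k \<le>
      card {\<sigma>. \<sigma> \<subseteq> {..<n} \<and> (\<forall>i\<in>{..<n}. if i \<in> \<sigma> then i + n \<notin> \<tau> else i \<notin> \<tau>)} * 2 ^ k"
    by simp
  also have "\<dots> \<le> 2 ^ n" using card_swaps_le[OF _ k] by simp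
  finally show ?thesis .
next
  case True
  show ?thesis unfolding True by simp
qed

text \<open>
  Exchanging \<open>s i\<close> and \<open>s (i + n)\<close> for \<open>i \<in> \<sigma>\<close> preserves the law of the double sample, and for a given
  trace at most \<open>2 ^ (n - k)\<close> of the \<open>2 ^ n\<close> choices of \<open>\<sigma>\<close> empty the first half while leaving at least
  \<open>k\<close> hits in the second.
\<close>

lemma measure_symmetrization_le:
  fixes \<Theta> :: "'t measure" and X :: "'x measure" and n k T :: nat
  defines "J \<equiv> {..<2*n}"
  assumes \<Theta>: "prob_space \<Theta>" and X: "prob_space X"
    and T: "\<And>t s. t \<in> space \<Theta> \<Longrightarrow> s \<in> space (PiM J (\<lambda>_. X)) \<Longrightarrow>
              card ((\<lambda>U. {i\<in>J. s i \<in> U}) ` F t) \<le> T"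
    and S: "S \<in> sets (\<Theta> \<Otimes>\<^sub>M PiM J (\<lambda>_. X))"
    and bad: "\<And>t s. (t, s) \<in> S \<Longrightarrow>
       \<exists>U\<in>F t. (\<forall>i<n. s i \<notin> U) \<and> k \<le> card {i\<in>{n..<2*n}. s i \<in> U}"
  shows "measure (\<Theta> \<Otimes>\<^sub>M PiM J (\<lambda>_. X)) S \<le> T / 2 ^ k"
proof -
  let ?P = "PiM J (\<lambda>_. X)" and ?M = "\<Theta> \<Otimes>\<^sub>M PiM J (\<lambda>_. X)"
  interpret T: prob_space \<Theta> by fact
  interpret X: prob_space X by fact
  interpret P: prob_space ?P by (intro prob_space_PiM X)
  interpret TP: pair_prob_space \<Theta> ?P ..
  define r where "r \<sigma> s = (\<lambda>i\<in>J. s (swap_blocks n \<sigma> i))" for \<sigma> and s :: "nat \<Rightarrow> 'x"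
  define R where "R \<sigma> = (\<lambda>(t :: 't, s). (t, r \<sigma> s))" for \<sigma>
  have r_meas: "r \<sigma> \<in> measurable ?P ?P" if "\<sigma> \<subseteq> {..<n}" for \<sigma>
    unfolding r_def using swap_blocks_less[OF that]
    by (intro measurable_restrict measurable_component_singleton) (auto simp: J_def)
  have R_meas: "R \<sigma> \<in> measurable ?M ?M" if "\<sigma> \<subseteq> {..<n}" for \<sigma>
    unfolding R_def using r_meas[OF that] by measurable
  have R_distr: "distr ?M ?M (R \<sigma>) = ?M" if "\<sigma> \<subseteq> {..<n}" for \<sigma>
  proof -
    have inj: "inj_on (swap_blocks n \<sigma>) J"
      using swap_blocks_involution[OF that] by (metis inj_onI)
    have "distr ?P ?P (r \<sigma>) = ?P"
      unfolding r_def by (rule distr_PiM_reindex)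
        (use X inj swap_blocks_less[OF that] in \<open>auto simp: J_def\<close>)
    moreover have "distr \<Theta> \<Theta> (\<lambda>t. t) = \<Theta>" by simp
    ultimately show ?thesis
      using pair_measure_distr[of "\<lambda>t. t" \<Theta> \<Theta> "r \<sigma>" ?P ?P] r_meas[OF that] P.sigma_finite_measure_axioms
      by (simp add: R_def)
  qed
  \<comment> \<open>Average over all swaps: each preserves the measure of S, so the sum is the
    integral of the number of \<sigma> that move a given point into S.\<close>
  have "2 ^ n * measure ?M S = (\<Sum>\<sigma>\<in>Pow {..<n}. measure ?M S)"
    by (simp add: card_Pow)
  also have "\<dots> = (\<Sum>\<sigma>\<in>Pow {..<n}. \<integral>x. indicator S (R \<sigma> x) \<partial>?M)"
  proof (intro sum.cong refl)
    fix \<sigma> assume "\<sigma> \<in> Pow {..<n}"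
    then have s: "\<sigma> \<subseteq> {..<n}" by simp
    have "measure ?M S = (\<integral>x. indicator S x \<partial>distr ?M ?M (R \<sigma>))"
      unfolding R_distr[OF s] using S by simp
    also have "\<dots> = (\<integral>x. indicator S (R \<sigma> x) \<partial>?M)"
      using S by (intro integral_distr R_meas s) auto
    finally show "measure ?M S = (\<integral>x. indicator S (R \<sigma> x) \<partial>?M)" .
  qed
  also have "\<dots> = (\<integral>x. (\<Sum>\<sigma>\<in>Pow {..<n}. indicator S (R \<sigma> x)) \<partial>?M)"
  proof (rule Bochner_Integration.integral_sum[symmetric])
    fix \<sigma> assume "\<sigma> \<in> Pow {..<n}"
    then have "(\<lambda>x. indicator S (R \<sigma> x) :: real) \<in> borel_measurable ?M"
      using measurable_compose[OF R_meas borel_measurable_indicator[OF S]] by auto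
    then show "integrable ?M (\<lambda>x. indicator S (R \<sigma> x) :: real)"
      by (rule TP.integrable_const_bound[of _ 1, rotated]) (auto simp: indicator_def)
  qed
  also have "\<dots> \<le> (\<integral>x. T * (2 ^ n / 2 ^ k) \<partial>?M)"
  proof (rule integral_mono_AE')
    show "integrable ?M (\<lambda>x. T * (2 ^ n / 2 ^ k) :: real)" by simp
    show "AE x in ?M. (\<Sum>\<sigma>\<in>Pow {..<n}. indicator S (R \<sigma> x)) \<le> T * (2 ^ n / 2 ^ k :: real)"
    proof (rule AE_I2)
      fix x assume "x \<in> space ?M"
      then obtain t s where x: "x = (t, s)" "t \<in> space \<Theta>" "s \<in> space ?P"
        by (auto simp: space_pair_measure)
      define Tr where "Tr = (\<lambda>U. {i\<in>J. s i \<in> U}) ` F t"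
      define A where "A \<tau> = {\<sigma>. \<sigma> \<subseteq> {..<n} \<and> (\<forall>i<n. swap_blocks n \<sigma> i \<notin> \<tau>) \<and>
         k \<le> card {i \<in> {n..<2*n}. swap_blocks n \<sigma> i \<in> \<tau>}}" for \<tau>
      have finA: "finite (A \<tau>)" for \<tau>
        by (rule finite_subset[of _ "Pow {..<n}"]) (auto simp: A_def)
      have finTr: "finite Tr"
        by (rule finite_subset[of _ "Pow J"]) (auto simp: Tr_def J_def)
      \<comment> \<open>Each such \<sigma> is charged to the trace of a witnessing U on the
        unswapped sample. There are at most T traces, and each receives at most 2^n / 2^k
        swaps.\<close>
      have "{\<sigma>\<in>Pow {..<n}. R \<sigma> x \<in> S} \<subseteq> (\<Union>\<tau>\<in>Tr. A \<tau>)"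
      proof
        fix \<sigma> assume "\<sigma> \<in> {\<sigma>\<in>Pow {..<n}. R \<sigma> x \<in> S}"
        then have s: "\<sigma> \<subseteq> {..<n}" and "(t, r \<sigma> s) \<in> S" by (auto simp: R_def x)
        from bad[OF this(2)] obtain U where U: "U \<in> F t" "\<forall>i<n. r \<sigma> s i \<notin> U"
          "k \<le> card {i\<in>{n..<2*n}. r \<sigma> s i \<in> U}" by auto
        let ?\<tau> = "{i\<in>J. s i \<in> U}"
        have eq: "r \<sigma> s i \<in> U \<longleftrightarrow> swap_blocks n \<sigma> i \<in> ?\<tau>" if "i < 2 * n" for i
          using that swap_blocks_less[OF s that] by (auto simp: r_def J_def)
        have "{i\<in>{n..<2*n}. r \<sigma> s i \<in> U} = {i \<in> {n..<2*n}. swap_blocks n \<sigma> i \<in> ?\<tau>}"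
          using eq by auto
        moreover have "\<forall>i<n. swap_blocks n \<sigma> i \<notin> ?\<tau>" using U(2) eq by auto
        ultimately have "\<sigma> \<in> A ?\<tau>" using s U(3) by (simp add: A_def)
        then show "\<sigma> \<in> (\<Union>\<tau>\<in>Tr. A \<tau>)" using U(1) by (auto simp: Tr_def)
      qed
      then have "card {\<sigma>\<in>Pow {..<n}. R \<sigma> x \<in> S} \<le> card (\<Union>\<tau>\<in>Tr. A \<tau>)"
        using finTr finA by (intro card_mono finite_UN_I)
      also have "\<dots> \<le> (\<Sum>\<tau>\<in>Tr. card (A \<tau>))"
        using finTr by (rule card_UN_le)
      finally have "real (card {\<sigma>\<in>Pow {..<n}. R \<sigma> x \<in> S}) \<le> real (\<Sum>\<tau>\<in>Tr. card (A \<tau>))"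
        by (rule of_nat_mono)
      also have "\<dots> = (\<Sum>\<tau>\<in>Tr. real (card (A \<tau>)))" by (rule of_nat_sum)
      also have "\<dots> \<le> (\<Sum>\<tau>\<in>Tr. 2 ^ n / 2 ^ k)"
      proof (rule sum_mono)
        fix \<tau>
        have "real (card (A \<tau>) * 2 ^ k) \<le> real (2 ^ n)"
          unfolding A_def by (rule of_nat_mono[OF card_swap_blocks_le])
        then show "real (card (A \<tau>)) \<le> 2 ^ n / 2 ^ k"
          by (simp add: field_simps)
      qed
      also have "\<dots> \<le> T * (2 ^ n / 2 ^ k)"
        using T[OF x(2,3)] by (simp add: Tr_def divide_right_mono mult_right_mono)
      also have "real (card {\<sigma>\<in>Pow {..<n}. R \<sigma> x \<in> S}) = (\<Sum>\<sigma>\<in>Pow {..<n}. indicator S (R \<sigma> x))"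
        by (simp add: indicator_def sum.If_cases Int_def conj_commute)
      finally show "(\<Sum>\<sigma>\<in>Pow {..<n}. indicator S (R \<sigma> x)) \<le> T * (2 ^ n / 2 ^ k :: real)" .
    qed
  qed (auto intro!: sum_nonneg)
  also have "\<dots> = 2 ^ n * (T / 2 ^ k)" by (simp add: TP.prob_space)
  finally show ?thesis by (rule mult_left_le_imp_le) simp
qed

section \<open>The epsilon-net theorem with parameters\<close>

text \<open>Fubini combined with \<open>distr_merge\<close>. It isolates the ghost sample on K: once
  t and the first sample on I are fixed, a probability over K alone remains.\<close>

lemma emeasure_pair_merge:
  fixes \<Theta> :: "'t measure" and X :: "'x measure"
  assumes \<Theta>: "prob_space \<Theta>" and X: "prob_space X" and IK: "I \<inter> K = {}" "finite I" "finite K"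
    and W: "W \<in> sets (\<Theta> \<Otimes>\<^sub>M PiM (I \<union> K) (\<lambda>_. X))"
  defines "h \<equiv> (\<lambda>((t, s), s'). (t, merge I K (s, s')))"
  shows "h \<in> measurable ((\<Theta> \<Otimes>\<^sub>M PiM I (\<lambda>_. X)) \<Otimes>\<^sub>M PiM K (\<lambda>_. X)) (\<Theta> \<Otimes>\<^sub>M PiM (I \<union> K) (\<lambda>_. X))"
    and "(\<lambda>x. emeasure (PiM K (\<lambda>_. X)) {s' \<in> space (PiM K (\<lambda>_. X)). h (x, s') \<in> W}) \<in>
      borel_measurable (\<Theta> \<Otimes>\<^sub>M PiM I (\<lambda>_. X))"
    and "emeasure (\<Theta> \<Otimes>\<^sub>M PiM (I \<union> K) (\<lambda>_. X)) W =
      (\<integral>\<^sup>+x. emeasure (PiM K (\<lambda>_. X)) {s' \<in> space (PiM K (\<lambda>_. X)). h (x, s') \<in> W} \<partial>(\<Theta> \<Otimes>\<^sub>M PiM I (\<lambda>_. X)))"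
proof -
  let ?I = "PiM I (\<lambda>_. X)" and ?K = "PiM K (\<lambda>_. X)" and ?J = "PiM (I \<union> K) (\<lambda>_. X)"
  interpret X: prob_space X by fact
  interpret T: prob_space \<Theta> by fact
  interpret PI: prob_space ?I by (intro prob_space_PiM X)
  interpret PK: prob_space ?K by (intro prob_space_PiM X)
  interpret PJ: prob_space ?J by (intro prob_space_PiM X)
  interpret product_sigma_finite "\<lambda>_. X" ..
  interpret TI: pair_sigma_finite \<Theta> ?I ..
  show h[measurable]: "h \<in> measurable ((\<Theta> \<Otimes>\<^sub>M ?I) \<Otimes>\<^sub>M ?K) (\<Theta> \<Otimes>\<^sub>M ?J)"
  proof -
    have "h = (\<lambda>x. (fst (fst x), merge I K (snd (fst x), snd x)))"
      by (auto simp: h_def fun_eq_iff)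
    then show ?thesis by simp
  qed
  note W[measurable]
  let ?W = "h -` W \<inter> space ((\<Theta> \<Otimes>\<^sub>M ?I) \<Otimes>\<^sub>M ?K)"
  have W': "?W \<in> sets ((\<Theta> \<Otimes>\<^sub>M ?I) \<Otimes>\<^sub>M ?K)" by measurable
  let ?f = "\<lambda>x. emeasure ?K {s' \<in> space ?K. h (x, s') \<in> W}"
  have sec: "Pair x -` ?W = {s' \<in> space ?K. h (x, s') \<in> W}" if "x \<in> space (\<Theta> \<Otimes>\<^sub>M ?I)" for x
    using that by (auto simp: space_pair_measure)
  show f: "?f \<in> borel_measurable (\<Theta> \<Otimes>\<^sub>M ?I)"
    using PK.measurable_emeasure_Pair[OF W'] by (rule measurable_cong[THEN iffD1, rotated]) (simp only: sec)
  have "emeasure (\<Theta> \<Otimes>\<^sub>M ?J) W = (\<integral>\<^sup>+t. emeasure ?J (Pair t -` W) \<partial>\<Theta>)"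
    by (intro PJ.emeasure_pair_measure_alt W)
  also have "\<dots> = (\<integral>\<^sup>+t. (\<integral>\<^sup>+s. ?f (t, s) \<partial>?I) \<partial>\<Theta>)"
  proof (rule nn_integral_cong)
    fix t assume t: "t \<in> space \<Theta>"
    have Wt: "Pair t -` W \<in> sets ?J" using W by (rule sets_Pair1)
    have "emeasure ?J (Pair t -` W) = emeasure (distr (?I \<Otimes>\<^sub>M ?K) ?J (merge I K)) (Pair t -` W)"
      using distr_merge[OF IK] by simp
    also have "\<dots> = emeasure (?I \<Otimes>\<^sub>M ?K) (merge I K -` (Pair t -` W) \<inter> space (?I \<Otimes>\<^sub>M ?K))"
      by (intro emeasure_distr measurable_merge Wt)
    also have "\<dots> = (\<integral>\<^sup>+s. emeasure ?K (Pair s -` (merge I K -` (Pair t -` W) \<inter> space (?I \<Otimes>\<^sub>M ?K))) \<partial>?I)"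
      by (intro PK.emeasure_pair_measure_alt measurable_sets[OF measurable_merge Wt])
    also have "\<dots> = (\<integral>\<^sup>+s. ?f (t, s) \<partial>?I)"
      by (intro nn_integral_cong arg_cong2[where f=emeasure] refl) (auto simp: space_pair_measure h_def)
    finally show "emeasure ?J (Pair t -` W) = (\<integral>\<^sup>+s. ?f (t, s) \<partial>?I)" .
  qed
  also have "\<dots> = (\<integral>\<^sup>+x. ?f x \<partial>(\<Theta> \<Otimes>\<^sub>M ?I))"
    using PI.nn_integral_fst[OF f] by simp
  finally show "emeasure (\<Theta> \<Otimes>\<^sub>M ?J) W = (\<integral>\<^sup>+x. ?f x \<partial>(\<Theta> \<Otimes>\<^sub>M ?I))" .
qed

text \<open>The number of hits is at most |K| and has mean at least e |K|. Applying
  \<open>reverse_markov\<close> to it replaces a concentration inequality, at the price of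
  probability e / 2 instead of nearly 1.\<close>

lemma prob_many_hits:
  fixes X :: "'x measure" and K :: "'i set" and e :: real
  assumes X: "prob_space X" and K: "finite K" "K \<noteq> {}" and U: "U \<in> sets X" "e \<le> measure X U"
    and k: "2 * real k \<le> card K * e"
  shows "e / 2 \<le> measure (PiM K (\<lambda>_. X)) {s \<in> space (PiM K (\<lambda>_. X)). k \<le> card {i\<in>K. s i \<in> U}}"
proof -
  let ?K = "PiM K (\<lambda>_. X)"
  interpret X: prob_space X by fact
  interpret prob_space ?K by (intro prob_space_PiM X)
  note U(1)[measurable]
  have card_eq: "real (card {i\<in>K. s i \<in> U}) = (\<Sum>i\<in>K. indicator U (s i))" for s
    using K by (simp add: indicator_def sum.If_cases Int_def)
  have m: "(\<lambda>s. indicator U (s i) :: real) \<in> borel_measurable ?K" if "i \<in> K" for i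
    using that by measurable
  have int: "integrable ?K (\<lambda>s. indicator U (s i) :: real)" if "i \<in> K" for i
    by (rule integrable_const_bound[of _ 1]) (auto simp: m[OF that] split: split_indicator)
  have E: "expectation (\<lambda>s. indicator U (s i)) = measure X U" if "i \<in> K" for i
  proof -
    have "measure X U = (\<integral>x. indicator U x \<partial>distr ?K X (\<lambda>s. s i))"
      using distr_PiM_component[of K "\<lambda>_. X" i] that X by simp
    also have "\<dots> = expectation (\<lambda>s. indicator U (s i))"
      using that by (intro integral_distr) auto
    finally show ?thesis ..
  qed
  have "expectation (\<lambda>s. \<Sum>i\<in>K. indicator U (s i) :: real) = (\<Sum>i\<in>K. expectation (\<lambda>s. indicator U (s i)))"
    by (intro Bochner_Integration.integral_sum int)
  also have "\<dots> = card K * measure X U" by (simp add: E)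
  finally have "e * card K \<le> expectation (\<lambda>s. \<Sum>i\<in>K. indicator U (s i))"
    using U(2) mult_right_mono[OF U(2), of "card K"] by (simp add: mult.commute)
  then have "e / 2 \<le> prob {s\<in>space ?K. real k \<le> (\<Sum>i\<in>K. indicator U (s i))}"
  proof (intro reverse_markov[where c="card K"])
    show "(\<lambda>s. \<Sum>i\<in>K. indicator U (s i) :: real) \<in> borel_measurable ?K"
      by (intro borel_measurable_sum m)
    show "0 \<le> (\<Sum>i\<in>K. indicator U (s i) :: real) \<and> (\<Sum>i\<in>K. indicator U (s i)) \<le> real (card K)" for s
      using K unfolding card_eq[symmetric] by (auto intro!: card_mono)
  qed (use k K in \<open>auto simp: card_gt_0_iff\<close>)
  then show ?thesis unfolding card_eq[symmetric] by simp
qed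

text \<open>
  The event to be covered by \<open>V\<close> need not be measurable.  Only its double-sample version is assumed to
  be universally measurable; \<open>V\<close> consists of the points where the ghost sample lands in a measurable
  hull of that version with probability at least \<open>e / 2\<close>.
\<close>

lemma parametrized_eps_net:
  fixes \<Theta> :: "'t measure" and X :: "'x measure" and n k T :: nat and e :: real
  defines "J \<equiv> {..<2*n}"
  assumes \<Theta>: "prob_space \<Theta>" and X: "prob_space X"
    and n: "n > 0" "e > 0" "2 * real k \<le> n * e"
    and F: "\<And>t U. t \<in> space \<Theta> \<Longrightarrow> U \<in> F t \<Longrightarrow> U \<in> sets X"
    and T: "\<And>t s. t \<in> space \<Theta> \<Longrightarrow> s \<in> space (PiM J (\<lambda>_. X)) \<Longrightarrow>
              card ((\<lambda>U. {i\<in>J. s i \<in> U}) ` F t) \<le> T"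
    and g: "g \<in> measurable (\<Theta> \<Otimes>\<^sub>M PiM J (\<lambda>_. X)) Y"
    and Z: "universally_measurable Y Z"
    and gZ: "\<And>t s. t \<in> space \<Theta> \<Longrightarrow> s \<in> space (PiM J (\<lambda>_. X)) \<Longrightarrow>
       g (t, s) \<in> Z \<longleftrightarrow> (\<exists>U\<in>F t. (\<forall>i<n. s i \<notin> U) \<and> k \<le> card {i\<in>{n..<2*n}. s i \<in> U})"
  shows "\<exists>V \<in> sets (\<Theta> \<Otimes>\<^sub>M PiM {..<n} (\<lambda>_. X)).
    measure (\<Theta> \<Otimes>\<^sub>M PiM {..<n} (\<lambda>_. X)) V \<le> 2 / e * (T / 2 ^ k) \<and>
    (\<forall>t \<in> space \<Theta>. \<forall>s \<in> space (PiM {..<n} (\<lambda>_. X)). \<forall>U \<in> F t.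
       e \<le> measure X U \<longrightarrow> (\<forall>i<n. s i \<notin> U) \<longrightarrow> (t, s) \<in> V)"
proof -
  define I where "I = {..<n}"
  define K where "K = {n..<2*n}"
  have IK: "I \<inter> K = {}" "finite I" "finite K" "K \<noteq> {}" and J: "J = I \<union> K" and card_K: "card K = n"
    using n by (auto simp: I_def K_def J_def)
  let ?I = "PiM I (\<lambda>_. X)" and ?K = "PiM K (\<lambda>_. X)" and ?J = "PiM J (\<lambda>_. X)"
  let ?M = "\<Theta> \<Otimes>\<^sub>M ?J"
  interpret X: prob_space X by fact
  interpret T: prob_space \<Theta> by fact
  interpret PI: prob_space ?I by (intro prob_space_PiM X)
  interpret PK: prob_space ?K by (intro prob_space_PiM X)
  interpret PJ: prob_space ?J by (intro prob_space_PiM X)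
  interpret TI: pair_prob_space \<Theta> ?I ..
  interpret TJ: pair_prob_space \<Theta> ?J ..
  \<comment> \<open>Z is enclosed between measurable sets of equal measure under the law of g. The
    inner one consists of genuinely bad double samples and obeys the symmetrization bound, which
    thereby passes to the outer one.\<close>
  have "prob_space (distr ?M Y g)" using g by (rule TJ.prob_space_distr)
  from universally_measurableD[OF Z this sets_distr] obtain S' W' where
    S'W': "S' \<in> sets Y" "W' \<in> sets Y" "S' \<subseteq> Z" "Z \<subseteq> W'"
      "measure (distr ?M Y g) W' = measure (distr ?M Y g) S'" by auto
  define S where "S = g -` S' \<inter> space ?M"
  define W where "W = g -` W' \<inter> space ?M"
  have S: "S \<in> sets ?M" and W: "W \<in> sets ?M"
    using S'W' g by (auto simp: S_def W_def)
  have eq: "measure ?M W = measure ?M S"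
    using S'W' g by (simp add: measure_distr S_def W_def)
  have "measure ?M S \<le> T / 2 ^ k"
  proof (rule measure_symmetrization_le[OF \<Theta> X, of n F T S k, folded J_def])
    fix t s assume "(t, s) \<in> S"
    then have "t \<in> space \<Theta>" "s \<in> space ?J" "g (t, s) \<in> Z"
      using S'W' by (auto simp: S_def space_pair_measure)
    with gZ show "\<exists>U\<in>F t. (\<forall>i<n. s i \<notin> U) \<and> k \<le> card {i\<in>{n..<2*n}. s i \<in> U}" by blast
  qed (use T S in auto)
  then have mW: "measure ?M W \<le> T / 2 ^ k" using eq by simp
  define h :: "('t \<times> (nat \<Rightarrow> 'x)) \<times> (nat \<Rightarrow> 'x) \<Rightarrow> 't \<times> (nat \<Rightarrow> 'x)"
    where "h = (\<lambda>((t, s), s'). (t, merge I K (s, s')))"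
  note h = emeasure_pair_merge[OF \<Theta> X IK(1-3) W[unfolded J], folded h_def, folded J]
  note h(1)[measurable] W[measurable]
  define f where "f x = measure ?K {s' \<in> space ?K. h (x, s') \<in> W}" for x
  define V where "V = {x \<in> space (\<Theta> \<Otimes>\<^sub>M ?I). e / 2 \<le> f x}"
  have f_meas[measurable]: "f \<in> borel_measurable (\<Theta> \<Otimes>\<^sub>M ?I)"
    unfolding f_def measure_def using h(2) by measurable
  have V: "V \<in> sets (\<Theta> \<Otimes>\<^sub>M ?I)" unfolding V_def by measurable
  \<comment> \<open>Markov's inequality: on V the ghost sample completes to a point of W with
    probability at least e / 2, which costs the factor 2 / e.\<close>
  have "ennreal (e / 2) * emeasure (\<Theta> \<Otimes>\<^sub>M ?I) V = (\<integral>\<^sup>+x. ennreal (e / 2) * indicator V x \<partial>(\<Theta> \<Otimes>\<^sub>M ?I))"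
    using V by (simp add: nn_integral_cmult_indicator)
  also have "\<dots> \<le> (\<integral>\<^sup>+x. emeasure ?K {s' \<in> space ?K. h (x, s') \<in> W} \<partial>(\<Theta> \<Otimes>\<^sub>M ?I))"
    by (intro nn_integral_mono) (auto simp: V_def f_def indicator_def PK.emeasure_eq_measure intro: ennreal_leI)
  also have "\<dots> = emeasure ?M W" using h(3) by simp
  finally have "e / 2 * measure (\<Theta> \<Otimes>\<^sub>M ?I) V \<le> measure ?M W"
    using n(2) by (simp add: TI.emeasure_eq_measure TJ.emeasure_eq_measure ennreal_mult[symmetric])
  then have "measure (\<Theta> \<Otimes>\<^sub>M ?I) V \<le> 2 / e * measure ?M W"
    using n(2) by (simp add: field_simps)
  also have "\<dots> \<le> 2 / e * (T / 2 ^ k)"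
    using n(2) mW by (intro mult_left_mono) auto
  finally have mV: "measure (\<Theta> \<Otimes>\<^sub>M ?I) V \<le> 2 / e * (T / 2 ^ k)" .
  have "(t, s) \<in> V" if t: "t \<in> space \<Theta>" and s: "s \<in> space ?I" and U: "U \<in> F t"
     "e \<le> measure X U" "\<forall>i<n. s i \<notin> U" for t s U
  proof -
    note F[OF t U(1), measurable]
    \<comment> \<open>If the first sample misses a heavy U, the ghost sample hits U at least k times
      with probability e / 2 or more, and every such ghost sample leads into Z and so into
      W.\<close>
    have "e / 2 \<le> measure ?K {s' \<in> space ?K. k \<le> card {i\<in>K. s' i \<in> U}}"
      using F[OF t U(1)] U(2) n(3) IK card_K by (intro prob_many_hits X) auto
    also have "\<dots> \<le> f (t, s)"
      unfolding f_def
    proof (rule PK.finite_measure_mono)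
      show "{s' \<in> space ?K. k \<le> card {i\<in>K. s' i \<in> U}} \<subseteq> {s' \<in> space ?K. h ((t, s), s') \<in> W}"
      proof safe
        fix s' assume s': "s' \<in> space ?K" "k \<le> card {i\<in>K. s' i \<in> U}"
        have m: "merge I K (s, s') \<in> space ?J"
          unfolding J using s s'(1) by (auto simp: space_PiM PiE_iff merge_def extensional_def)
        have "{i\<in>{n..<2*n}. merge I K (s, s') i \<in> U} = {i\<in>K. s' i \<in> U}"
          by (rule Collect_cong) (auto simp: K_def I_def merge_def)
        then have "k \<le> card {i\<in>{n..<2*n}. merge I K (s, s') i \<in> U}" using s'(2) by simp
        moreover have "\<forall>i<n. merge I K (s, s') i \<notin> U" using U(3) by (simp add: I_def merge_def)
        ultimately have "g (t, merge I K (s, s')) \<in> Z"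
          unfolding gZ[OF t m] using U(1) by blast
        then have "(t, merge I K (s, s')) \<in> W"
          using S'W'(4) t m unfolding W_def space_pair_measure by blast
        then show "h ((t, s), s') \<in> W" by (simp add: h_def)
      qed
      show "{s' \<in> space ?K. h ((t, s), s') \<in> W} \<in> sets ?K"
      proof -
        have "(\<lambda>s'. ((t, s), s')) \<in> measurable ?K ((\<Theta> \<Otimes>\<^sub>M ?I) \<Otimes>\<^sub>M ?K)"
          using t s by (intro measurable_Pair1') (simp add: space_pair_measure)
        from measurable_sets[OF measurable_compose[OF this h(1)] W] show ?thesis
          by (simp add: vimage_def Int_def conj_commute)
      qed
    qed
    finally show ?thesis using t s by (simp add: V_def space_pair_measure)
  qed
  then show ?thesis using V mV unfolding I_def by blast
qed

section \<open>Trace counts and nets for slices\<close>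

text \<open>A shattered set of d + 1 indices, enumerated by z, would realize every pattern on the
  points \<open>s (z i)\<close>. Traces are sets of indices, so repeated sample values do no
  harm.\<close>

lemma card_traces_le:
  fixes P :: "'h \<Rightarrow> 'x \<Rightarrow> bool"
  assumes vc: "\<And>z :: nat \<Rightarrow> 'x. \<exists>A. A \<subseteq> {0..d} \<and> (\<forall>H\<in>\<G>. {i\<in>{0..d}. P H (z i)} \<noteq> A)"
    and J: "finite J"
  shows "card ((\<lambda>H. {i\<in>J. P H (s i)}) ` \<G>) \<le> (card J + 1) ^ d"
proof (rule sauer_shelah[OF J])
  fix K assume K: "K \<subseteq> J" "card K = Suc d"
  then obtain z where z: "bij_betw z {0..d} K"
    using ex_bij_betw_nat_finite[of K] J finite_subset[of K J]
    by (metis atLeastLessThanSuc_atLeastAtMost)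
  obtain A where A: "A \<subseteq> {0..d}" "\<And>H. H \<in> \<G> \<Longrightarrow> {i\<in>{0..d}. P H (s (z i))} \<noteq> A"
    using vc[of "\<lambda>i. s (z i)"] by auto
  have inj: "inj_on z {0..d}" and img: "z ` {0..d} = K" using z by (auto simp: bij_betw_def)
  show "\<not> shattered ((\<lambda>H. {i\<in>J. P H (s i)}) ` \<G>) K"
  proof
    assume "shattered ((\<lambda>H. {i\<in>J. P H (s i)}) ` \<G>) K"
    moreover have "z ` A \<subseteq> K" using A(1) img by blast
    ultimately obtain H where H: "H \<in> \<G>" "{i\<in>J. P H (s i)} \<inter> K = z ` A"
      unfolding shattered_def by (metis (no_types, lifting) imageE)
    have "P H (s (z i)) \<longleftrightarrow> i \<in> A" if "i \<in> {0..d}" for i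
    proof -
      have "z i \<in> K" using that img by blast
      then have "P H (s (z i)) \<longleftrightarrow> z i \<in> z ` A" using H(2) K(1) by blast
      also have "\<dots> \<longleftrightarrow> i \<in> A" using inj A(1) that by (auto dest: inj_onD)
      finally show ?thesis .
    qed
    then have "{i\<in>{0..d}. P H (s (z i))} = A" using A(1) by blast
    with A(2)[OF H(1)] show False by simp
  qed
qed auto

text \<open>The trace of the union is computed from the 2r traces of G and of H at the slices j < r,
  each of which takes at most L values.\<close>

lemma card_pair_traces_le:
  fixes P :: "'h \<Rightarrow> nat \<Rightarrow> 'x \<Rightarrow> bool"
  assumes vc: "\<And>j. j < r \<Longrightarrow> card ((\<lambda>H. {i\<in>J. P H j (s i)}) ` \<G>) \<le> L"
    and J: "finite J"
  shows "card ((\<lambda>U. {i\<in>J. s i \<in> U}) ` {{y. \<exists>j<r. P G j y \<noteq> P H j y} | G H. G \<in> \<G> \<and> H \<in> \<G>}) \<le> L ^ (2 * r)"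
    (is "card ?A \<le> _")
proof -
  define Tr where "Tr j = (\<lambda>H. {i\<in>J. P H j (s i)}) ` \<G>" for j
  define B where "B = PiE {..<r} (\<lambda>j. Tr j \<times> Tr j)"
  define f where "f p = (\<Union>j<r. sym_diff (fst (p j)) (snd (p j)))" for p :: "nat \<Rightarrow> 'a set \<times> 'a set"
  have fin: "finite (Tr j)" for j
    by (rule finite_subset[of _ "Pow J"]) (auto simp: Tr_def J)
  then have finB: "finite B" by (auto simp: B_def intro!: finite_PiE)
  have "?A \<subseteq> f ` B"
  proof
    fix \<tau> assume "\<tau> \<in> ?A"
    then obtain G H where GH: "G \<in> \<G>" "H \<in> \<G>" "\<tau> = {i\<in>J. \<exists>j<r. P G j (s i) \<noteq> P H j (s i)}" by auto
    define p where "p = (\<lambda>j\<in>{..<r}. ({i\<in>J. P G j (s i)}, {i\<in>J. P H j (s i)}))"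
    have "p \<in> B" using GH(1,2) by (auto simp: p_def B_def Tr_def)
    moreover have "\<tau> = f p" unfolding GH(3) f_def p_def by auto
    ultimately show "\<tau> \<in> f ` B" by blast
  qed
  then have "card ?A \<le> card (f ` B)" using finB by (intro card_mono) auto
  also have "\<dots> \<le> card B" using finB by (rule card_image_le)
  also have "\<dots> = (\<Prod>j<r. card (Tr j) * card (Tr j))"
    by (simp add: B_def card_PiE card_cartesian_product)
  also have "\<dots> \<le> (\<Prod>j<r. L * L)"
    using vc by (intro prod_mono) (auto simp: Tr_def intro!: mult_mono)
  also have "\<dots> = L ^ (2 * r)" by (simp add: power_mult power2_eq_square)
  finally show ?thesis .
qed

text \<open>Take n = p k with p at least 2 / e. Then 2 k \<le> n e, and 2^k outgrows any polynomial
  in n of the fixed degree D. Choosing k above n0 also secures the lower bounds on n.\<close>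

lemma exists_sample_size:
  fixes e \<delta> :: real
  assumes "e > 0" "\<delta> > 0"
  shows "\<exists>n k. n \<ge> n0 \<and> n > 0 \<and> 2 * real k \<le> n * e \<and> 2 / e * (real ((2 * n + 1) ^ D) / 2 ^ k) \<le> \<delta>"
proof -
  define p where "p = nat \<lceil>2 / e\<rceil> + 1"
  have p: "real p * e \<ge> 2" "p > 0"
  proof -
    have "2 / e \<le> real p" unfolding p_def by linarith
    then show "real p * e \<ge> 2" using assms by (simp add: field_simps)
  qed (simp add: p_def)
  have "(\<lambda>k. 2 / e * (real ((2 * (p * k) + 1) ^ D) / 2 ^ k)) \<longlonglongrightarrow> 0"
  proof -
    have "(\<lambda>k. 2 / e * ((2 * (real p * real k) + 1) ^ D / 2 ^ k)) \<longlonglongrightarrow> 0"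
      using p(2) assms(1) by real_asymp
    then show ?thesis by (simp add: add.commute)
  qed
  then have "\<forall>\<^sub>F k in sequentially. 2 / e * (real ((2 * (p * k) + 1) ^ D) / 2 ^ k) < \<delta>"
    using assms(2) by (rule order_tendstoD)
  then have "\<forall>\<^sub>F k in sequentially. 2 / e * (real ((2 * (p * k) + 1) ^ D) / 2 ^ k) < \<delta> \<and> n0 + 1 \<le> k"
    using eventually_ge_at_top[of "n0 + 1"] by eventually_elim auto
  then obtain k where k: "2 / e * (real ((2 * (p * k) + 1) ^ D) / 2 ^ k) < \<delta>" "n0 + 1 \<le> k"
    by (metis (no_types, lifting) eventually_happens trivial_limit_sequentially)
  have "k \<le> p * k" using p by simp
  then have pk: "0 < p * k" "n0 \<le> p * k" using k(2) by linarith+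
  have "2 * real k \<le> real (p * k) * e"
    using mult_right_mono[OF p(1), of "real k"] by (simp add: algebra_simps)
  with pk less_imp_le[OF k(1)] show ?thesis by blast
qed

text \<open>The form of the net theorem that is applied twice: with one slice at the parameter x
  itself, and for the converse class with r slices at the sampled points of b.\<close>

lemma slice_net:
  fixes \<Theta> :: "'t measure" and X :: "real measure" and c :: "nat \<Rightarrow> 't \<Rightarrow> real"
  assumes \<Theta>: "prob_space \<Theta>" and X: "prob_space X" "sets X = sets borel"
    and n: "n > 0" "e > 0" "2 * real k \<le> n * e"
    and c: "\<And>j. j < r \<Longrightarrow> c j \<in> borel_measurable \<Theta>"
    and \<G>: "\<G> \<subseteq> sets borel" "slicewise_VC_dim_le \<G> d" "patterns_universally_measurable \<G>"
  shows "\<exists>V \<in> sets (\<Theta> \<Otimes>\<^sub>M PiM {..<n} (\<lambda>_. X)).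
    measure (\<Theta> \<Otimes>\<^sub>M PiM {..<n} (\<lambda>_. X)) V \<le> 2 / e * (real ((2 * n + 1) ^ (2 * d * r)) / 2 ^ k) \<and>
    (\<forall>t \<in> space \<Theta>. \<forall>s \<in> space (PiM {..<n} (\<lambda>_. X)). \<forall>G \<in> \<G>. \<forall>H \<in> \<G>.
       e \<le> measure X {y. \<exists>j<r. ((c j t, y) \<in> G) \<noteq> ((c j t, y) \<in> H)} \<longrightarrow>
       (\<forall>i<n. \<forall>j<r. (c j t, s i) \<in> G \<longleftrightarrow> (c j t, s i) \<in> H) \<longrightarrow> (t, s) \<in> V)"
proof -
  let ?D = "\<lambda>t G H. {y. \<exists>j<r. ((c j t, y) \<in> G) \<noteq> ((c j t, y) \<in> H)}"
  define F where "F t = {?D t G H | G H. G \<in> \<G> \<and> H \<in> \<G>}" for t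
  \<comment> \<open>One sequence holds the coordinates \<open>c j t\<close> at indices below r and
    the double sample behind them, so entry (j, r + i) of a pattern records whether
    \<open>(c j t, s i)\<close> belongs to the hypothesis. \<open>Q\<close> is the bad event read
    off two patterns.\<close>
  define N where "N = r + 2 * n"
  define Q where "Q p q \<longleftrightarrow> (\<forall>i<n. \<forall>j<r. (j, r + i) \<in> p \<longleftrightarrow> (j, r + i) \<in> q) \<and>
      k \<le> card {i\<in>{n..<2*n}. \<exists>j<r. ((j, r + i) \<in> p) \<noteq> ((j, r + i) \<in> q)}" for p q :: "(nat \<times> nat) set"
  define Z where "Z = {v. \<exists>G\<in>\<G>. \<exists>H\<in>\<G>. Q (grid_pattern N v G) (grid_pattern N v H)}"
  \<comment> \<open>From N on the value is an arbitrary 0, as patterns of size N read only earlier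
    entries.\<close>
  define g :: "'t \<times> (nat \<Rightarrow> real) \<Rightarrow> nat \<Rightarrow> real"
    where "g = (\<lambda>(t, s) i. if i < r then c i t else if i < N then s (i - r) else 0)"
  let ?J = "{..<2*n}"
  have "(\<lambda>x. g x i) \<in> borel_measurable (\<Theta> \<Otimes>\<^sub>M PiM ?J (\<lambda>_. X))" for i
  proof -
    consider "i < r" | "r \<le> i" "i < N" | "r \<le> i" "N \<le> i" by linarith
    then show ?thesis
    proof cases
      case 1
      then show ?thesis using measurable_compose[OF measurable_fst c[OF 1]] by (simp add: g_def case_prod_beta')
    next
      case 2
      then have "i - r \<in> ?J" by (auto simp: N_def)
      then have "(\<lambda>s. s (i - r)) \<in> measurable (PiM ?J (\<lambda>_. X)) X" by simp
      then have "(\<lambda>s. s (i - r)) \<in> borel_measurable (PiM ?J (\<lambda>_. X))"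
        using measurable_cong_sets[OF refl X(2)] by blast
      from measurable_compose[OF measurable_snd this] show ?thesis
        using 2 by (simp add: g_def case_prod_beta')
    next
      case 3
      then show ?thesis by (simp add: g_def case_prod_beta')
    qed
  qed
  then have g: "g \<in> borel_measurable (\<Theta> \<Otimes>\<^sub>M PiM ?J (\<lambda>_. X))"
    by (rule measurable_coordinatewise_then_product)
  have sec: "{y. (w, y) \<in> G} \<in> sets X" if "G \<in> \<G>" for w G
  proof -
    have "Pair w -` G \<in> sets (borel :: real measure)"
      using \<G>(1) that by (intro sets_Pair1[of _ borel]) (subst borel_prod, blast)
    then show ?thesis using X(2) by (simp add: vimage_def)
  qed
  have FX: "U \<in> sets X" if U: "U \<in> F t" for U t
  proof -
    obtain G H where "G \<in> \<G>" "H \<in> \<G>" "U = ?D t G H" using U by (auto simp: F_def)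
    moreover have "?D t G H = (\<Union>j<r. sym_diff {y. (c j t, y) \<in> G} {y. (c j t, y) \<in> H})" by auto
    ultimately show ?thesis using sec by auto
  qed
  have VC: "\<exists>A. A \<subseteq> {0..d} \<and> (\<forall>H\<in>\<G>. {i\<in>{0..d}. (w, z i) \<in> H} \<noteq> A)" for w and z :: "nat \<Rightarrow> real"
    using \<G>(2) unfolding slicewise_VC_dim_le_def by meson
  have tr: "card ((\<lambda>U. {i\<in>?J. s i \<in> U}) ` F t) \<le> (2 * n + 1) ^ (2 * d * r)" for s t
  proof -
    have "card ((\<lambda>H. {i\<in>?J. (c j t, s i) \<in> H}) ` \<G>) \<le> (2 * n + 1) ^ d" for j
      using card_traces_le[where P="\<lambda>H y. (c j t, y) \<in> H", OF VC[of "c j t"], of ?J s] by simp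
    from card_pair_traces_le[where P="\<lambda>H j y. (c j t, y) \<in> H" and r=r and s=s, OF this finite_lessThan]
    have "card ((\<lambda>U. {i\<in>?J. s i \<in> U}) ` F t) \<le> ((2 * n + 1) ^ d) ^ (2 * r)"
      by (simp add: F_def)
    then show ?thesis by (simp add: power_mult[symmetric] mult_ac)
  qed
  have Zum: "universally_measurable borel Z"
    unfolding Z_def by (intro universally_measurable_pair_pattern \<G>)
  have gZ: "g (t, s) \<in> Z \<longleftrightarrow> (\<exists>U\<in>F t. (\<forall>i<n. s i \<notin> U) \<and> k \<le> card {i\<in>{n..<2*n}. s i \<in> U})" for t s
  proof -
    have pat: "(j, r + i) \<in> grid_pattern N (g (t, s)) G \<longleftrightarrow> (c j t, s i) \<in> G" if "i < 2 * n" "j < r" for i j G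
      using that by (simp add: grid_pattern_def g_def N_def)
    have "Q (grid_pattern N (g (t, s)) G) (grid_pattern N (g (t, s)) H) \<longleftrightarrow>
       (\<forall>i<n. s i \<notin> ?D t G H) \<and> k \<le> card {i\<in>{n..<2*n}. s i \<in> ?D t G H}" for G H
    proof -
      have "{i\<in>{n..<2*n}. \<exists>j<r. ((j, r + i) \<in> grid_pattern N (g (t, s)) G) \<noteq> ((j, r + i) \<in> grid_pattern N (g (t, s)) H)}
         = {i\<in>{n..<2*n}. s i \<in> ?D t G H}"
        by (rule Collect_cong) (auto simp: pat)
      moreover have "(\<forall>i<n. \<forall>j<r. (j, r + i) \<in> grid_pattern N (g (t, s)) G \<longleftrightarrow> (j, r + i) \<in> grid_pattern N (g (t, s)) H)
         \<longleftrightarrow> (\<forall>i<n. s i \<notin> ?D t G H)"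
        by (auto simp: pat)
      ultimately show ?thesis unfolding Q_def by simp
    qed
    then show ?thesis unfolding Z_def F_def by blast
  qed
  have "\<exists>V \<in> sets (\<Theta> \<Otimes>\<^sub>M PiM {..<n} (\<lambda>_. X)).
    measure (\<Theta> \<Otimes>\<^sub>M PiM {..<n} (\<lambda>_. X)) V \<le> 2 / e * (real ((2 * n + 1) ^ (2 * d * r)) / 2 ^ k) \<and>
    (\<forall>t \<in> space \<Theta>. \<forall>s \<in> space (PiM {..<n} (\<lambda>_. X)). \<forall>U \<in> F t.
       e \<le> measure X U \<longrightarrow> (\<forall>i<n. s i \<notin> U) \<longrightarrow> (t, s) \<in> V)"
    by (rule parametrized_eps_net[OF \<Theta> X(1) n _ tr g Zum gZ]) (rule FX)
  then obtain V where V: "V \<in> sets (\<Theta> \<Otimes>\<^sub>M PiM {..<n} (\<lambda>_. X))"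
    "measure (\<Theta> \<Otimes>\<^sub>M PiM {..<n} (\<lambda>_. X)) V \<le> 2 / e * (real ((2 * n + 1) ^ (2 * d * r)) / 2 ^ k)"
    "\<forall>t \<in> space \<Theta>. \<forall>s \<in> space (PiM {..<n} (\<lambda>_. X)). \<forall>U \<in> F t.
       e \<le> measure X U \<longrightarrow> (\<forall>i<n. s i \<notin> U) \<longrightarrow> (t, s) \<in> V"
    by (elim bexE conjE) (rule that)
  show ?thesis
  proof (intro bexI[OF _ V(1)] conjI V(2) ballI impI)
    fix t s G H
    assume *: "t \<in> space \<Theta>" "s \<in> space (PiM {..<n} (\<lambda>_. X))" "G \<in> \<G>" "H \<in> \<G>" "e \<le> measure X (?D t G H)"
      "\<forall>i<n. \<forall>j<r. (c j t, s i) \<in> G \<longleftrightarrow> (c j t, s i) \<in> H"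
    have "?D t G H \<in> F t" using *(3,4) unfolding F_def by blast
    with V(3) *(1,2,5) have "(\<forall>i<n. s i \<notin> ?D t G H) \<longrightarrow> (t, s) \<in> V" by simp
    with *(6) show "(t, s) \<in> V" by simp
  qed
qed

section \<open>Separation by a random grid\<close>

lemma slicewise_VC_dim_le_converse:
  assumes "slicewise_VC_dim_le \<G> d"
  shows "slicewise_VC_dim_le (converse ` \<G>) d"
  unfolding slicewise_VC_dim_le_def
proof (intro allI)
  fix w :: real and z :: "nat \<Rightarrow> real"
  obtain A B where "A \<subseteq> {0..d}" "B \<subseteq> {0..d}"
    "\<forall>H\<in>\<G>. {i \<in> {0..d}. (w, z i) \<in> H} \<noteq> A \<and> {i \<in> {0..d}. (z i, w) \<in> H} \<noteq> B"
    using assms unfolding slicewise_VC_dim_le_def by meson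
  then show "\<exists>A B. A \<subseteq> {0..d} \<and> B \<subseteq> {0..d} \<and> (\<forall>H\<in>converse ` \<G>.
      {i \<in> {0..d}. (w, z i) \<in> H} \<noteq> A \<and> {i \<in> {0..d}. (z i, w) \<in> H} \<noteq> B)"
    by (intro exI[of _ B] exI[of _ A] conjI) simp_all
qed

lemma patterns_converse:
  assumes "patterns_universally_measurable \<G>"
  shows "patterns_universally_measurable (converse ` \<G>)"
  unfolding patterns_universally_measurable_def
proof (intro allI)
  fix N p
  have "grid_pattern N v (H\<inverse>) = p \<longleftrightarrow> grid_pattern N v H = p\<inverse>" for v H
    by (auto simp: grid_pattern_def)
  then show "universally_measurable borel {v. \<exists>H\<in>converse ` \<G>. grid_pattern N v H = p}"
    using assms by (simp add: patterns_universally_measurable_def)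
qed

lemma converse_borel:
  fixes H :: "('a :: second_countable_topology \<times> 'b :: second_countable_topology) set"
  assumes "H \<in> sets borel"
  shows "H\<inverse> \<in> sets borel"
proof -
  have "(\<lambda>(x, y). (y, x)) \<in> measurable (borel \<Otimes>\<^sub>M borel) (borel \<Otimes>\<^sub>M borel :: ('a \<times> 'b) measure)"
    by (rule measurable_pair_swap')
  then have "(\<lambda>(x, y). (y, x)) \<in> measurable (borel :: ('b \<times> 'a) measure) (borel :: ('a \<times> 'b) measure)"
    by (simp add: borel_prod)
  from measurable_sets[OF this assms] show ?thesis
    by (simp add: vimage_def converse_unfold case_prod_beta')
qed

text \<open>Markov's inequality for the section measures, whose mean is the measure of V by Fubini.
  For b outside \<open>L\<close> the exceptional x have measure below c.\<close>

lemma measure_large_sections_le: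
  assumes A: "prob_space A" and B: "prob_space B" and V: "V \<in> sets (A \<Otimes>\<^sub>M B)" and c: "c > 0"
  defines "L \<equiv> {b \<in> space B. c \<le> measure A {x \<in> space A. (x, b) \<in> V}}"
  shows "L \<in> sets B" and "measure B L \<le> measure (A \<Otimes>\<^sub>M B) V / c"
proof -
  interpret A: prob_space A by fact
  interpret B: prob_space B by fact
  interpret AB: pair_prob_space A B ..
  have sec: "(\<lambda>x. (x, b)) -` V = {x \<in> space A. (x, b) \<in> V}" for b
    using sets.sets_into_space[OF V] by (auto simp: space_pair_measure)
  have m: "(\<lambda>b. emeasure A {x \<in> space A. (x, b) \<in> V}) \<in> borel_measurable B"
    using AB.measurable_emeasure_Pair2[OF V] by (simp add: sec)
  then have "(\<lambda>b. measure A {x \<in> space A. (x, b) \<in> V}) \<in> borel_measurable B"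
    unfolding measure_def by measurable
  then show L: "L \<in> sets B" unfolding L_def by measurable
  have "ennreal c * emeasure B L = (\<integral>\<^sup>+b. ennreal c * indicator L b \<partial>B)"
    using L by (simp add: nn_integral_cmult_indicator)
  also have "\<dots> \<le> (\<integral>\<^sup>+b. emeasure A {x \<in> space A. (x, b) \<in> V} \<partial>B)"
    by (intro nn_integral_mono) (auto simp: L_def indicator_def A.emeasure_eq_measure intro: ennreal_leI)
  also have "\<dots> = emeasure (A \<Otimes>\<^sub>M B) V"
    using AB.emeasure_pair_measure_alt2[OF V] by (simp add: sec)
  finally have "c * measure B L \<le> measure (A \<Otimes>\<^sub>M B) V"
    using c by (simp add: AB.emeasure_eq_measure B.emeasure_eq_measure ennreal_mult[symmetric])
  then show "measure B L \<le> measure (A \<Otimes>\<^sub>M B) V / c" using c by (simp add: field_simps)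
qed

text \<open>The second net is parametrized by only r points of b and lists them first, whereas the
  final event concerns all m points of a and then of b. Restricting and exchanging carries one law
  to the other.\<close>

lemma distr_restrict_swap:
  assumes X: "prob_space X" and A: "prob_space A" and K: "K \<subseteq> J" "finite J"
  defines "\<rho> \<equiv> (\<lambda>(a, b). (restrict b K, a))"
  shows "\<rho> \<in> measurable (A \<Otimes>\<^sub>M PiM J (\<lambda>_. X)) (PiM K (\<lambda>_. X) \<Otimes>\<^sub>M A)"
    and "distr (A \<Otimes>\<^sub>M PiM J (\<lambda>_. X)) (PiM K (\<lambda>_. X) \<Otimes>\<^sub>M A) \<rho> = PiM K (\<lambda>_. X) \<Otimes>\<^sub>M A"
proof -
  let ?J = "PiM J (\<lambda>_. X)" and ?K = "PiM K (\<lambda>_. X)"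
  interpret X: prob_space X by fact
  interpret A: prob_space A by fact
  interpret PJ: prob_space ?J by (intro prob_space_PiM X)
  interpret JA: pair_sigma_finite ?J A ..
  interpret product_prob_space "\<lambda>_. X" ..
  have r: "(\<lambda>b. restrict b K) \<in> measurable ?J ?K"
    by (rule measurable_restrict_subset[OF K(1)])
  have d: "distr ?J ?K (\<lambda>b. restrict b K) = ?K"
    using distr_restrict[OF K] by simp
  let ?g = "\<lambda>(b, a). (restrict b K, a)" and ?sw = "\<lambda>(a, b). (b, a)"
  have g: "?g \<in> measurable (?J \<Otimes>\<^sub>M A) (?K \<Otimes>\<^sub>M A)" using r by measurable
  have sw: "?sw \<in> measurable (A \<Otimes>\<^sub>M ?J) (?J \<Otimes>\<^sub>M A)" by (rule measurable_pair_swap')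
  have comp: "\<rho> = ?g \<circ> ?sw" by (auto simp: \<rho>_def)
  show "\<rho> \<in> measurable (A \<Otimes>\<^sub>M ?J) (?K \<Otimes>\<^sub>M A)"
    unfolding comp using sw g by (rule measurable_comp)
  have "distr (A \<Otimes>\<^sub>M ?J) (?K \<Otimes>\<^sub>M A) \<rho> = distr (distr (A \<Otimes>\<^sub>M ?J) (?J \<Otimes>\<^sub>M A) ?sw) (?K \<Otimes>\<^sub>M A) ?g"
    unfolding comp by (rule distr_distr[OF g sw, symmetric])
  also have "distr (A \<Otimes>\<^sub>M ?J) (?J \<Otimes>\<^sub>M A) ?sw = ?J \<Otimes>\<^sub>M A"
    using JA.distr_pair_swap by simp
  also have "distr (?J \<Otimes>\<^sub>M A) (?K \<Otimes>\<^sub>M A) ?g = ?K \<Otimes>\<^sub>M A"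
    using pair_measure_distr[OF r, of "\<lambda>t. t" A A] d A.sigma_finite_measure_axioms by simp
  finally show "distr (A \<Otimes>\<^sub>M ?J) (?K \<Otimes>\<^sub>M A) \<rho> = ?K \<Otimes>\<^sub>M A" .
qed

definition agree_on_grid :: "nat \<Rightarrow> (nat \<Rightarrow> 'a) \<Rightarrow> (nat \<Rightarrow> 'b) \<Rightarrow> ('a \<times> 'b) set \<Rightarrow> ('a \<times> 'b) set \<Rightarrow> bool" where
  "agree_on_grid m a b G H \<longleftrightarrow> (\<forall>i<m. \<forall>j<m. (a i, b j) \<in> G \<longleftrightarrow> (a i, b j) \<in> H)"

text \<open>The sizes r and m come from e and d alone, before the class and the measures are
  given.\<close>

lemma random_grid_separates:
  fixes e :: real and d :: nat
  assumes e: "e > 0"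
  shows "\<exists>m>0. \<forall>\<G> \<mu>\<^sub>0 \<mu>\<^sub>1. \<G> \<subseteq> sets borel \<longrightarrow> slicewise_VC_dim_le \<G> d \<longrightarrow> patterns_universally_measurable \<G> \<longrightarrow>
       prob_space \<mu>\<^sub>0 \<longrightarrow> sets \<mu>\<^sub>0 = sets borel \<longrightarrow> prob_space \<mu>\<^sub>1 \<longrightarrow> sets \<mu>\<^sub>1 = sets borel \<longrightarrow>
       with_prob_at_least (PiM {..<m} (\<lambda>_. \<mu>\<^sub>0) \<Otimes>\<^sub>M PiM {..<m} (\<lambda>_. \<mu>\<^sub>1)) (1 / 2)
         (\<lambda>(a, b). \<forall>G\<in>\<G>. \<forall>H\<in>\<G>. agree_on_grid m a b G H \<longrightarrow>
            measure (\<mu>\<^sub>0 \<Otimes>\<^sub>M \<mu>\<^sub>1) (sym_diff G H) \<le> e)"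
proof -
  have half: "e / 2 > 0" and quarter: "e / 4 > 0" using e by auto
  \<comment> \<open>Failure e / 16 for the pair (x, b) leaves, by Markov at level e / 4, probability
    at most 1/4 that b has too many exceptional x.\<close>
  obtain r k where rk: "r > 0" "2 * real k \<le> r * (e / 2)"
    "2 / (e / 2) * (real ((2 * r + 1) ^ (2 * d * 1)) / 2 ^ k) \<le> e / 16"
    using exists_sample_size[of "e / 2" "e / 16" 0 "2 * d * 1"] e by auto
  \<comment> \<open>The degree \<open>2 * d * r\<close> involves r, so m is chosen second; m \<ge> r
    puts the r points of b on the final grid.\<close>
  obtain m l where ml: "m \<ge> r" "m > 0" "2 * real l \<le> m * (e / 4)"
    "2 / (e / 4) * (real ((2 * m + 1) ^ (2 * d * r)) / 2 ^ l) \<le> 1 / 4"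
    using exists_sample_size[of "e / 4" "1 / 4" r "2 * d * r"] e by auto
  show ?thesis
  proof (rule exI[of _ m], intro conjI ml(2) allI impI)
    fix \<G> and \<mu>\<^sub>0 \<mu>\<^sub>1 :: "real measure"
    assume \<G>: "\<G> \<subseteq> sets borel" "slicewise_VC_dim_le \<G> d" "patterns_universally_measurable \<G>"
      and \<mu>\<^sub>0: "prob_space \<mu>\<^sub>0" "sets \<mu>\<^sub>0 = sets borel" and \<mu>\<^sub>1: "prob_space \<mu>\<^sub>1" "sets \<mu>\<^sub>1 = sets borel"
    let ?a = "PiM {..<m} (\<lambda>_. \<mu>\<^sub>0)" and ?b = "PiM {..<m} (\<lambda>_. \<mu>\<^sub>1)" and ?\<beta> = "PiM {..<r} (\<lambda>_. \<mu>\<^sub>1)"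
    interpret m0: prob_space \<mu>\<^sub>0 by fact
    interpret m1: prob_space \<mu>\<^sub>1 by fact
    interpret a: prob_space ?a by (intro prob_space_PiM \<mu>\<^sub>0)
    interpret b: prob_space ?b by (intro prob_space_PiM \<mu>\<^sub>1)
    interpret \<beta>: prob_space ?\<beta> by (intro prob_space_PiM \<mu>\<^sub>1)
    interpret ab: pair_prob_space ?a ?b ..
    interpret \<beta>a: pair_prob_space ?\<beta> ?a ..
    interpret m01: pair_prob_space \<mu>\<^sub>0 \<mu>\<^sub>1 ..
    have sp: "space \<mu>\<^sub>0 = UNIV" "space \<mu>\<^sub>1 = UNIV"
      using sets_eq_imp_space_eq[OF \<mu>\<^sub>0(2)] sets_eq_imp_space_eq[OF \<mu>\<^sub>1(2)] by auto
    have id: "(\<lambda>t. t) \<in> borel_measurable \<mu>\<^sub>0"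
      unfolding measurable_cong_sets[OF \<mu>\<^sub>0(2) refl] by (rule measurable_ident_sets) simp
    \<comment> \<open>First net: the parameter is a single x, and the sample consists of r points
      from \<open>\<mu>\<^sub>1\<close>.\<close>
    from slice_net[of \<mu>\<^sub>0 \<mu>\<^sub>1 r "e / 2" k "1::nat" "\<lambda>_ t. t" \<G> d,
        OF \<mu>\<^sub>0(1) \<mu>\<^sub>1 rk(1) half rk(2) id \<G>]
    obtain V where V: "V \<in> sets (\<mu>\<^sub>0 \<Otimes>\<^sub>M ?\<beta>)"
      "measure (\<mu>\<^sub>0 \<Otimes>\<^sub>M ?\<beta>) V \<le> 2 / (e / 2) * (real ((2 * r + 1) ^ (2 * d * 1)) / 2 ^ k)"
      and V_sep: "\<forall>x \<in> space \<mu>\<^sub>0. \<forall>s \<in> space ?\<beta>. \<forall>G \<in> \<G>. \<forall>H \<in> \<G>.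
         e / 2 \<le> measure \<mu>\<^sub>1 {y. \<exists>j<1::nat. ((x, y) \<in> G) \<noteq> ((x, y) \<in> H)} \<longrightarrow>
         (\<forall>i<r. \<forall>j<1::nat. (x, s i) \<in> G \<longleftrightarrow> (x, s i) \<in> H) \<longrightarrow> (x, s) \<in> V"
      by (elim bexE conjE) (rule that)
    have comp: "(\<lambda>t. t j) \<in> borel_measurable ?\<beta>" if "j < r" for j
      using measurable_component_singleton[of j "{..<r}" "\<lambda>_. \<mu>\<^sub>1"] that
      unfolding measurable_cong_sets[OF refl \<mu>\<^sub>1(2)] by simp
    have conv: "converse ` \<G> \<subseteq> sets borel" using \<G>(1) converse_borel by blast
    \<comment> \<open>Second net: horizontal slices become slices of the converses, the r points of
      b are the parameters, and the sample consists of m points from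
      \<open>\<mu>\<^sub>0\<close>.\<close>
    have "\<exists>V' \<in> sets (?\<beta> \<Otimes>\<^sub>M ?a).
      measure (?\<beta> \<Otimes>\<^sub>M ?a) V' \<le> 2 / (e / 4) * (real ((2 * m + 1) ^ (2 * d * r)) / 2 ^ l) \<and>
      (\<forall>t \<in> space ?\<beta>. \<forall>s \<in> space ?a. \<forall>G \<in> converse ` \<G>. \<forall>H \<in> converse ` \<G>.
         e / 4 \<le> measure \<mu>\<^sub>0 {y. \<exists>j<r. ((t j, y) \<in> G) \<noteq> ((t j, y) \<in> H)} \<longrightarrow>
         (\<forall>i<m. \<forall>j<r. (t j, s i) \<in> G \<longleftrightarrow> (t j, s i) \<in> H) \<longrightarrow> (t, s) \<in> V')"
      by (rule slice_net[OF \<beta>.prob_space_axioms \<mu>\<^sub>0 ml(2) quarter ml(3) _ conv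
          slicewise_VC_dim_le_converse[OF \<G>(2)] patterns_converse[OF \<G>(3)]]) (rule comp)
    then obtain V' where V': "V' \<in> sets (?\<beta> \<Otimes>\<^sub>M ?a)"
      "measure (?\<beta> \<Otimes>\<^sub>M ?a) V' \<le> 2 / (e / 4) * (real ((2 * m + 1) ^ (2 * d * r)) / 2 ^ l)"
      and V'_sep: "\<forall>t \<in> space ?\<beta>. \<forall>s \<in> space ?a. \<forall>G \<in> converse ` \<G>. \<forall>H \<in> converse ` \<G>.
         e / 4 \<le> measure \<mu>\<^sub>0 {y. \<exists>j<r. ((t j, y) \<in> G) \<noteq> ((t j, y) \<in> H)} \<longrightarrow>
         (\<forall>i<m. \<forall>j<r. (t j, s i) \<in> G \<longleftrightarrow> (t j, s i) \<in> H) \<longrightarrow> (t, s) \<in> V'"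
      by (elim bexE conjE) (rule that)
    define L where "L = {b \<in> space ?\<beta>. e / 4 \<le> measure \<mu>\<^sub>0 {x \<in> space \<mu>\<^sub>0. (x, b) \<in> V}}"
    have L: "L \<in> sets ?\<beta>" and "measure ?\<beta> L \<le> measure (\<mu>\<^sub>0 \<Otimes>\<^sub>M ?\<beta>) V / (e / 4)"
      unfolding L_def using measure_large_sections_le[OF \<mu>\<^sub>0(1) \<beta>.prob_space_axioms V(1), of "e / 4"] e by auto
    note this(2)
    also have "measure (\<mu>\<^sub>0 \<Otimes>\<^sub>M ?\<beta>) V / (e / 4) \<le> (e / 16) / (e / 4)"
      using V(2) rk(3) e by (intro divide_right_mono) auto
    finally have mL: "measure ?\<beta> L \<le> 1 / 4" using e by simp
    \<comment> \<open>Either net fails with probability at most 1/4.\<close>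
    define Bad where "Bad = (L \<times> space ?a) \<union> V'"
    have Bad: "Bad \<in> sets (?\<beta> \<Otimes>\<^sub>M ?a)" using L V'(1) by (auto simp: Bad_def)
    have "measure (?\<beta> \<Otimes>\<^sub>M ?a) Bad \<le> measure (?\<beta> \<Otimes>\<^sub>M ?a) (L \<times> space ?a) + measure (?\<beta> \<Otimes>\<^sub>M ?a) V'"
      unfolding Bad_def using L V'(1) by (intro measure_Un_le) auto
    also have "measure (?\<beta> \<Otimes>\<^sub>M ?a) (L \<times> space ?a) = measure ?\<beta> L"
      using L by (simp add: measure_def a.emeasure_pair_measure_Times a.emeasure_space_1)
    finally have mBad: "measure (?\<beta> \<Otimes>\<^sub>M ?a) Bad \<le> 1 / 2" using mL V'(2) ml(4) by simp
    define \<rho> :: "(nat \<Rightarrow> real) \<times> (nat \<Rightarrow> real) \<Rightarrow> (nat \<Rightarrow> real) \<times> (nat \<Rightarrow> real)"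
      where "\<rho> = (\<lambda>(a, b). (restrict b {..<r}, a))"
    have \<rho>: "\<rho> \<in> measurable (?a \<Otimes>\<^sub>M ?b) (?\<beta> \<Otimes>\<^sub>M ?a)"
      "distr (?a \<Otimes>\<^sub>M ?b) (?\<beta> \<Otimes>\<^sub>M ?a) \<rho> = ?\<beta> \<Otimes>\<^sub>M ?a"
      unfolding \<rho>_def using distr_restrict_swap[OF \<mu>\<^sub>1(1) a.prob_space_axioms, of "{..<r}" "{..<m}"] ml(1) by auto
    define Ev where "Ev = space (?a \<Otimes>\<^sub>M ?b) - (\<rho> -` Bad \<inter> space (?a \<Otimes>\<^sub>M ?b))"
    have pre: "\<rho> -` Bad \<inter> space (?a \<Otimes>\<^sub>M ?b) \<in> sets (?a \<Otimes>\<^sub>M ?b)" using \<rho>(1) Bad by (rule measurable_sets)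
    then have sets_Ev: "Ev \<in> sets (?a \<Otimes>\<^sub>M ?b)" unfolding Ev_def by blast
    have "measure (?a \<Otimes>\<^sub>M ?b) (\<rho> -` Bad \<inter> space (?a \<Otimes>\<^sub>M ?b)) = measure (?\<beta> \<Otimes>\<^sub>M ?a) Bad"
      using measure_distr[OF \<rho>(1) Bad] \<rho>(2) by simp
    then have mEv: "measure (?a \<Otimes>\<^sub>M ?b) Ev \<ge> 1 / 2"
      unfolding Ev_def using ab.prob_compl[OF pre] mBad by simp
    have "measure (\<mu>\<^sub>0 \<Otimes>\<^sub>M \<mu>\<^sub>1) (sym_diff G H) \<le> e"
      if ab: "(a, b) \<in> Ev" and GH: "G \<in> \<G>" "H \<in> \<G>" and agree: "agree_on_grid m a b G H" for a b G H
    proof (rule ccontr)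
      define \<beta>' where "\<beta>' = restrict b {..<r}"
      assume large: "\<not> measure (\<mu>\<^sub>0 \<Otimes>\<^sub>M \<mu>\<^sub>1) (sym_diff G H) \<le> e"
      have sp_ab: "a \<in> space ?a" "b \<in> space ?b" using ab by (auto simp: Ev_def space_pair_measure)
      have sp_\<beta>: "\<beta>' \<in> space ?\<beta>"
        using sp_ab(2) ml(1) by (auto simp: \<beta>'_def space_PiM sp)
      have nL: "\<beta>' \<notin> L" and nV': "(\<beta>', a) \<notin> V'"
        using ab sp_ab by (auto simp: Ev_def \<rho>_def Bad_def \<beta>'_def space_pair_measure)
      have D: "sym_diff G H \<in> sets (\<mu>\<^sub>0 \<Otimes>\<^sub>M \<mu>\<^sub>1)"
        using GH \<G>(1) sets_pair_measure_cong[OF \<mu>\<^sub>0(2) \<mu>\<^sub>1(2)] unfolding borel_prod by auto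
      define f where "f x = measure \<mu>\<^sub>1 {y. ((x, y) \<in> G) \<noteq> ((x, y) \<in> H)}" for x
      have sec: "Pair x -` sym_diff G H = {y. ((x, y) \<in> G) \<noteq> ((x, y) \<in> H)}" for x by auto
      have f_meas: "f \<in> borel_measurable \<mu>\<^sub>0"
        using m1.measurable_emeasure_Pair[OF D] unfolding f_def measure_def sec by measurable
      have "(\<lambda>x. (x, \<beta>')) -` V \<in> sets \<mu>\<^sub>0" by (rule sets_Pair2[OF V(1)])
      then have meas_V: "{x \<in> space \<mu>\<^sub>0. (x, \<beta>') \<in> V} \<in> sets \<mu>\<^sub>0"
        by (simp add: vimage_def sp)
      have "(\<Union>j<r. (\<lambda>x. (x, b j)) -` sym_diff G H) \<in> sets \<mu>\<^sub>0"
        by (intro sets.finite_UN sets_Pair2[OF D] finite_lessThan)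
      also have "(\<Union>j<r. (\<lambda>x. (x, b j)) -` sym_diff G H) = {x. \<exists>j<r. ((x, b j) \<in> G) \<noteq> ((x, b j) \<in> H)}"
        by auto
      finally have meas_U: "{x. \<exists>j<r. ((x, b j) \<in> G) \<noteq> ((x, b j) \<in> H)} \<in> sets \<mu>\<^sub>0" .
      \<comment> \<open>The slice measures f have mean above e and never exceed 1, so slices of
        measure e / 2 occur on a set of x of measure at least e / 2.\<close>
      have "e / 2 \<le> measure \<mu>\<^sub>0 {x\<in>space \<mu>\<^sub>0. e / 2 \<le> f x}"
      proof (rule m0.reverse_markov[OF f_meas, of 1])
        have "emeasure (\<mu>\<^sub>0 \<Otimes>\<^sub>M \<mu>\<^sub>1) (sym_diff G H) = (\<integral>\<^sup>+x. ennreal (f x) \<partial>\<mu>\<^sub>0)"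
          unfolding m1.emeasure_pair_measure_alt[OF D] sec f_def by (simp add: m1.emeasure_eq_measure)
        also have "\<dots> = ennreal (integral\<^sup>L \<mu>\<^sub>0 f)"
          by (intro nn_integral_eq_integral m0.integrable_const_bound[of _ 1] f_meas)
             (auto simp: f_def)
        finally have "measure (\<mu>\<^sub>0 \<Otimes>\<^sub>M \<mu>\<^sub>1) (sym_diff G H) = integral\<^sup>L \<mu>\<^sub>0 f"
          by (simp add: m01.emeasure_eq_measure f_def)
        then show "e * 1 \<le> integral\<^sup>L \<mu>\<^sub>0 f" using large by simp
      qed (auto simp: f_def)
      \<comment> \<open>Such an x is exceptional for the first net, or some b_j with j < r lies in
        its slice. Since \<beta>' is outside \<open>L\<close>, the former have measure below e / 4,
        leaving at least e / 4 for \<open>?U\<close>.\<close>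
      also have "\<dots> \<le> measure \<mu>\<^sub>0 ({x \<in> space \<mu>\<^sub>0. (x, \<beta>') \<in> V} \<union> {x. \<exists>j<r. ((x, b j) \<in> G) \<noteq> ((x, b j) \<in> H)})"
        (is "_ \<le> measure \<mu>\<^sub>0 (?V \<union> ?U)")
      proof (rule m0.finite_measure_mono)
        show "{x\<in>space \<mu>\<^sub>0. e / 2 \<le> f x} \<subseteq> ?V \<union> ?U"
        proof
          fix x assume x: "x \<in> {x\<in>space \<mu>\<^sub>0. e / 2 \<le> f x}"
          show "x \<in> ?V \<union> ?U"
          proof (cases "x \<in> ?U")
            case False
            then have "(x, \<beta>' i) \<in> G \<longleftrightarrow> (x, \<beta>' i) \<in> H" if "i < r" for i
              using that by (auto simp: \<beta>'_def)
            then have "(x, \<beta>') \<in> V" 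
              using x sp_\<beta> GH by (intro V_sep[rule_format, of x \<beta>' G H]) (auto simp: f_def)
            then show ?thesis using x by auto
          qed simp
        qed
        show "?V \<union> ?U \<in> sets \<mu>\<^sub>0" using meas_V meas_U by (rule sets.Un)
      qed
      also have "\<dots> \<le> measure \<mu>\<^sub>0 ?V + measure \<mu>\<^sub>0 ?U"
        using meas_V meas_U by (rule measure_Un_le)
      finally have "e / 4 \<le> measure \<mu>\<^sub>0 ?U"
        using nL sp_\<beta> by (auto simp: L_def)
      also have "?U = {y. \<exists>j<r. ((\<beta>' j, y) \<in> G\<inverse>) \<noteq> ((\<beta>' j, y) \<in> H\<inverse>)}"
        by (rule Collect_cong) (auto simp: \<beta>'_def)
      finally have "(\<beta>', a) \<in> V'"
        using agree ml(1) GH sp_\<beta> sp_ab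
        by (intro V'_sep[rule_format, of \<beta>' a "G\<inverse>" "H\<inverse>"]) (auto simp: \<beta>'_def agree_on_grid_def)
      with nV' show False by simp
    qed
    then show "with_prob_at_least (?a \<Otimes>\<^sub>M ?b) (1 / 2)
         (\<lambda>(a, b). \<forall>G\<in>\<G>. \<forall>H\<in>\<G>. agree_on_grid m a b G H \<longrightarrow>
            measure (\<mu>\<^sub>0 \<Otimes>\<^sub>M \<mu>\<^sub>1) (sym_diff G H) \<le> e)"
      unfolding with_prob_at_least_def using sets_Ev mEv by (intro bexI[of _ Ev]) auto
  qed
qed

section \<open>From definable realizability to the three items\<close>

lemma with_prob_at_least_mono:
  assumes "with_prob_at_least P p Q" "\<And>\<omega>. \<omega> \<in> space P \<Longrightarrow> Q \<omega> \<Longrightarrow> R \<omega>"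
  shows "with_prob_at_least P p R"
  using assms sets.sets_into_space unfolding with_prob_at_least_def by (meson subsetD)

lemma with_prob_at_least_nonempty:
  assumes "with_prob_at_least P p Q" "p > 0"
  obtains \<omega> where "\<omega> \<in> space P" "Q \<omega>"
proof -
  obtain E where E: "E \<in> sets P" "measure P E \<ge> p" "\<forall>\<omega>\<in>E. Q \<omega>"
    using assms(1) by (auto simp: with_prob_at_least_def)
  then have "E \<noteq> {}" using assms(2) by auto
  then obtain \<omega> where "\<omega> \<in> E" by auto
  then show thesis using E(3) sets.sets_into_space[OF E(1)] by (intro that) auto
qed

lemma grid_params_tuples: "grid_params k a b l \<in> tuples (2 * k + k\<^sup>2)"
  by (simp add: grid_params_def)

lemma induced_labeling_labelings: "induced_labeling k a b C \<in> labelings k"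
  by (auto simp: induced_labeling_def split: if_splits)

lemma agree_on_grid_iff: "agree_on_grid k a b G H \<longleftrightarrow> G \<inter> grid k a b = H \<inter> grid k a b"
  by (auto simp: agree_on_grid_def grid_def)

lemma definably_realizable_on_gridsD:
  fixes a b :: "nat \<Rightarrow> real"
  assumes "definably_realizable_on_grids \<H> \<C> \<phi>" "a \<in> tuples k" "b \<in> tuples k" "C \<in> \<C>"
  defines "D \<equiv> definable_set (\<phi> k) (grid_params k a b (induced_labeling k a b C))"
  shows "D \<in> \<H>" "agree_on_grid k a b D C"
  using assms by (auto simp: definably_realizable_on_grids_def Let_def agree_on_grid_iff)

text \<open>On d + 1 points the vertical and the horizontal slice of C coincide with slices of
  members of \<H>, so patterns missed by \<H> are missed by C. Repeating w in one coordinate turns a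
  grid of side d + 1 into a single slice.\<close>

lemma slicewise_VC_dim_le_insert:
  assumes "slicewise_VC_dim_le \<H> d" "definably_realizable_on_grids \<H> \<C> \<phi>" "C \<in> \<C>"
  shows "slicewise_VC_dim_le (Set.insert C \<H>) d"
  unfolding slicewise_VC_dim_le_def
proof (intro allI)
  fix w :: real and z :: "nat \<Rightarrow> real"
  let ?w = "\<lambda>i\<in>{..<Suc d}. w" and ?z = "\<lambda>i\<in>{..<Suc d}. z i"
  obtain A B where AB: "A \<subseteq> {0..d}" "B \<subseteq> {0..d}"
    "\<forall>H\<in>\<H>. {i \<in> {0..d}. (w, z i) \<in> H} \<noteq> A \<and> {i \<in> {0..d}. (z i, w) \<in> H} \<noteq> B"
    using assms unfolding slicewise_VC_dim_le_def by meson
  have tup: "?w \<in> tuples (Suc d)" "?z \<in> tuples (Suc d)" by auto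
  obtain D where D: "D \<in> \<H>" "agree_on_grid (Suc d) ?w ?z D C"
    using definably_realizable_on_gridsD[OF assms(2) tup(1,2) assms(3)] by blast
  obtain D' where D': "D' \<in> \<H>" "agree_on_grid (Suc d) ?z ?w D' C"
    using definably_realizable_on_gridsD[OF assms(2) tup(2,1) assms(3)] by blast
  have "{i \<in> {0..d}. (w, z i) \<in> C} = {i \<in> {0..d}. (w, z i) \<in> D}"
    using D(2) by (auto simp: agree_on_grid_def less_Suc_eq_le)
  moreover have "{i \<in> {0..d}. (z i, w) \<in> C} = {i \<in> {0..d}. (z i, w) \<in> D'}"
    using D'(2) by (auto simp: agree_on_grid_def less_Suc_eq_le)
  ultimately show "\<exists>A B. A \<subseteq> {0..d} \<and> B \<subseteq> {0..d} \<and> (\<forall>H\<in>Set.insert C \<H>.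
      {i \<in> {0..d}. (w, z i) \<in> H} \<noteq> A \<and> {i \<in> {0..d}. (z i, w) \<in> H} \<noteq> B)"
    using AB D(1) D'(1) by (intro exI[of _ A] exI[of _ B] conjI) simp_all
qed

theorem theorem3p8:
  fixes \<epsilon> :: real and d :: nat
  assumes "\<epsilon> > 0"
  shows "\<exists>m::nat. m > 0 \<and>
    (\<forall>(\<H> :: (real \<times> real) set set) (\<C> :: (real \<times> real) set set) (\<phi> :: nat \<Rightarrow> oring_formula).
       \<H> \<subseteq> \<C> \<and> \<C> \<subseteq> sets borel \<and>
       hypothesis_class \<H> \<and> slicewise_VC_dim_le \<H> d \<and>
       definably_realizable_on_grids \<H> \<C> \<phi> \<longrightarrow>
       (\<forall>(\<mu>\<^sub>0 :: real measure) (\<mu>\<^sub>1 :: real measure).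
          prob_space \<mu>\<^sub>0 \<and> sets \<mu>\<^sub>0 = sets borel \<and> prob_space \<mu>\<^sub>1 \<and> sets \<mu>\<^sub>1 = sets borel \<longrightarrow>
          (\<forall>C\<in>\<C>. \<exists>c \<in> tuples (2 * m + m\<^sup>2).
             close_to \<mu>\<^sub>0 \<mu>\<^sub>1 (\<epsilon> / 2) (definable_set (\<phi> m) c) C) \<and>
          (\<exists>a \<in> tuples m. \<exists>b \<in> tuples m. grid_approximates \<mu>\<^sub>0 \<mu>\<^sub>1 \<epsilon> \<C> m (\<phi> m) a b) \<and>
          with_prob_at_least (PiM {..<m} (\<lambda>_. \<mu>\<^sub>0) \<Otimes>\<^sub>M PiM {..<m} (\<lambda>_. \<mu>\<^sub>1)) (1 / 2)
            (\<lambda>(a, b). grid_approximates \<mu>\<^sub>0 \<mu>\<^sub>1 \<epsilon> \<C> m (\<phi> m) a b)))"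
proof -
  \<comment> \<open>Item (1) spends this once; items (2) and (3) spend it twice through the triangle
    inequality.\<close>
  have "\<epsilon> / 2 > 0" using assms by simp
  from random_grid_separates[OF this, of d] obtain m where m: "m > 0"
    and sep: "\<forall>\<G> \<mu>\<^sub>0 \<mu>\<^sub>1. \<G> \<subseteq> sets borel \<longrightarrow> slicewise_VC_dim_le \<G> d \<longrightarrow> patterns_universally_measurable \<G> \<longrightarrow>
       prob_space \<mu>\<^sub>0 \<longrightarrow> sets \<mu>\<^sub>0 = sets borel \<longrightarrow> prob_space \<mu>\<^sub>1 \<longrightarrow> sets \<mu>\<^sub>1 = sets borel \<longrightarrow>
       with_prob_at_least (PiM {..<m} (\<lambda>_. \<mu>\<^sub>0) \<Otimes>\<^sub>M PiM {..<m} (\<lambda>_. \<mu>\<^sub>1)) (1 / 2)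
         (\<lambda>(a, b). \<forall>G\<in>\<G>. \<forall>H\<in>\<G>. agree_on_grid m a b G H \<longrightarrow>
            measure (\<mu>\<^sub>0 \<Otimes>\<^sub>M \<mu>\<^sub>1) (sym_diff G H) \<le> \<epsilon> / 2)"
    by (elim exE conjE) (rule that)
  show ?thesis
  proof (rule exI[of _ m], intro conjI m allI impI; elim conjE)
    fix \<H> \<C> \<phi> and \<mu>\<^sub>0 \<mu>\<^sub>1 :: "real measure"
    assume \<H>\<C>: "\<H> \<subseteq> \<C>" "\<C> \<subseteq> sets borel" and hyp: "hypothesis_class \<H>" "slicewise_VC_dim_le \<H> d"
      and real: "definably_realizable_on_grids \<H> \<C> \<phi>"
      and \<mu>: "prob_space \<mu>\<^sub>0" "sets \<mu>\<^sub>0 = sets borel" "prob_space \<mu>\<^sub>1" "sets \<mu>\<^sub>1 = sets borel"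
    let ?P = "PiM {..<m} (\<lambda>_. \<mu>\<^sub>0) \<Otimes>\<^sub>M PiM {..<m} (\<lambda>_. \<mu>\<^sub>1)"
    let ?D = "\<lambda>a b l. definable_set (\<phi> m) (grid_params m a b l)"
    interpret P0: prob_space \<mu>\<^sub>0 by fact
    interpret P1: prob_space \<mu>\<^sub>1 by fact
    interpret PP: pair_prob_space \<mu>\<^sub>0 \<mu>\<^sub>1 ..
    have "space \<mu>\<^sub>0 = UNIV" "space \<mu>\<^sub>1 = UNIV"
      using sets_eq_imp_space_eq[OF \<mu>(2)] sets_eq_imp_space_eq[OF \<mu>(4)] by auto
    then have space_P: "space ?P = tuples m \<times> tuples m"
      by (simp add: space_pair_measure space_PiM)
    have sets_\<mu>: "sets (\<mu>\<^sub>0 \<Otimes>\<^sub>M \<mu>\<^sub>1) = sets borel"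
      using sets_pair_measure_cong[OF \<mu>(2,4)] unfolding borel_prod .
    have pat: "patterns_universally_measurable \<H>" using hyp(1) by (rule hypothesis_class_patterns)
    \<comment> \<open>The grid may depend on C here. Separation is applied to \<H> with C adjoined,
      and the definable set realizing C on a good grid agrees with C there.\<close>
    have near: "\<exists>a\<in>tuples m. \<exists>b\<in>tuples m. \<exists>l. ?D a b l \<in> \<H> \<and>
        measure (\<mu>\<^sub>0 \<Otimes>\<^sub>M \<mu>\<^sub>1) (sym_diff (?D a b l) C) \<le> \<epsilon> / 2" if C: "C \<in> \<C>" for C
    proof -
      have borel: "Set.insert C \<H> \<subseteq> sets borel" "C \<in> sets borel" using C \<H>\<C> by auto
      have "with_prob_at_least ?P (1 / 2) (\<lambda>(a, b). \<forall>G\<in>Set.insert C \<H>. \<forall>H\<in>Set.insert C \<H>.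
         agree_on_grid m a b G H \<longrightarrow> measure (\<mu>\<^sub>0 \<Otimes>\<^sub>M \<mu>\<^sub>1) (sym_diff G H) \<le> \<epsilon> / 2)"
        by (rule sep[rule_format, OF borel(1) slicewise_VC_dim_le_insert[OF hyp(2) real C]
              patterns_insert[OF pat borel(2)] \<mu>])
      then obtain a b where ab: "a \<in> tuples m" "b \<in> tuples m"
        and close: "\<forall>G\<in>Set.insert C \<H>. \<forall>H\<in>Set.insert C \<H>.
         agree_on_grid m a b G H \<longrightarrow> measure (\<mu>\<^sub>0 \<Otimes>\<^sub>M \<mu>\<^sub>1) (sym_diff G H) \<le> \<epsilon> / 2"
        by (rule with_prob_at_least_nonempty) (auto simp: space_P)
      from definably_realizable_on_gridsD[OF real ab C] close ab show ?thesis by blast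
    qed
    have item1: "\<exists>c \<in> tuples (2 * m + m\<^sup>2). close_to \<mu>\<^sub>0 \<mu>\<^sub>1 (\<epsilon> / 2) (definable_set (\<phi> m) c) C"
      if "C \<in> \<C>" for C
      using near[OF that] \<H>\<C> grid_params_tuples unfolding close_to_def by (meson subsetD)
    \<comment> \<open>The event must now serve all C at once, so it is taken for \<H> alone.\<close>
    have "with_prob_at_least ?P (1 / 2) (\<lambda>(a, b). \<forall>G\<in>\<H>. \<forall>H\<in>\<H>.
         agree_on_grid m a b G H \<longrightarrow> measure (\<mu>\<^sub>0 \<Otimes>\<^sub>M \<mu>\<^sub>1) (sym_diff G H) \<le> \<epsilon> / 2)"
      by (rule sep[rule_format, OF order_trans[OF \<H>\<C>] hyp(2) pat \<mu>])
    then have item3: "with_prob_at_least ?P (1 / 2)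
        (\<lambda>(a, b). grid_approximates \<mu>\<^sub>0 \<mu>\<^sub>1 \<epsilon> \<C> m (\<phi> m) a b)"
    proof (rule with_prob_at_least_mono, clarify)
      fix a b
      assume "(a, b) \<in> space ?P" and close: "\<forall>G\<in>\<H>. \<forall>H\<in>\<H>.
         agree_on_grid m a b G H \<longrightarrow> measure (\<mu>\<^sub>0 \<Otimes>\<^sub>M \<mu>\<^sub>1) (sym_diff G H) \<le> \<epsilon> / 2"
      then have ab: "a \<in> tuples m" "b \<in> tuples m" by (auto simp: space_P)
      show "grid_approximates \<mu>\<^sub>0 \<mu>\<^sub>1 \<epsilon> \<C> m (\<phi> m) a b"
        unfolding grid_approximates_def
      proof
        fix C assume C: "C \<in> \<C>"
        from near[OF C] obtain H where H: "H \<in> \<H>" "measure (\<mu>\<^sub>0 \<Otimes>\<^sub>M \<mu>\<^sub>1) (sym_diff H C) \<le> \<epsilon> / 2"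
          by blast
        \<comment> \<open>The labels are those of a nearby H, not of C: the event compares only
          members of \<H>. As H also lies in \<C>, realizability provides a definable D in \<H>
          agreeing with H on the grid.\<close>
        define D where "D = ?D a b (induced_labeling m a b H)"
        have "H \<in> \<C>" using H \<H>\<C> by auto
        note D = definably_realizable_on_gridsD[OF real ab this, folded D_def]
        have "measure (\<mu>\<^sub>0 \<Otimes>\<^sub>M \<mu>\<^sub>1) (sym_diff D H) \<le> \<epsilon> / 2" using close D H(1) by blast
        moreover have "D \<in> sets borel" "H \<in> sets borel" "C \<in> sets borel"
          using D(1) H(1) C \<H>\<C> by auto
        then have "measure (\<mu>\<^sub>0 \<Otimes>\<^sub>M \<mu>\<^sub>1) (sym_diff D C) \<le>
            measure (\<mu>\<^sub>0 \<Otimes>\<^sub>M \<mu>\<^sub>1) (sym_diff D H \<union> sym_diff H C)"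
          by (intro PP.finite_measure_mono) (auto simp: sets_\<mu>)
        moreover have "\<dots> \<le> measure (\<mu>\<^sub>0 \<Otimes>\<^sub>M \<mu>\<^sub>1) (sym_diff D H) + measure (\<mu>\<^sub>0 \<Otimes>\<^sub>M \<mu>\<^sub>1) (sym_diff H C)"
          using \<open>D \<in> sets borel\<close> \<open>H \<in> sets borel\<close> \<open>C \<in> sets borel\<close>
          by (intro measure_Un_le) (auto simp: sets_\<mu>)
        ultimately have "close_to \<mu>\<^sub>0 \<mu>\<^sub>1 \<epsilon> D C"
          using H(2) \<open>D \<in> sets borel\<close> by (simp add: close_to_def)
        then show "\<exists>l \<in> labelings m. close_to \<mu>\<^sub>0 \<mu>\<^sub>1 \<epsilon> (?D a b l) C"
          unfolding D_def using induced_labeling_labelings by blast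
      qed
    qed
    \<comment> \<open>An event of probability at least 1/2 is nonempty, which yields item
      (2).\<close>
    obtain a b where "a \<in> tuples m" "b \<in> tuples m" "grid_approximates \<mu>\<^sub>0 \<mu>\<^sub>1 \<epsilon> \<C> m (\<phi> m) a b"
      using item3 by (rule with_prob_at_least_nonempty) (auto simp: space_P)
    with item1 item3 show "(\<forall>C\<in>\<C>. \<exists>c \<in> tuples (2 * m + m\<^sup>2).
             close_to \<mu>\<^sub>0 \<mu>\<^sub>1 (\<epsilon> / 2) (definable_set (\<phi> m) c) C)"
       "(\<exists>a \<in> tuples m. \<exists>b \<in> tuples m. grid_approximates \<mu>\<^sub>0 \<mu>\<^sub>1 \<epsilon> \<C> m (\<phi> m) a b)"
       "with_prob_at_least ?P (1 / 2) (\<lambda>(a, b). grid_approximates \<mu>\<^sub>0 \<mu>\<^sub>1 \<epsilon> \<C> m (\<phi> m) a b)"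
      by blast+
  qed
qed

end
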